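(* Let $n\ge 2$ and let $G$ be the complete graph with self-loops on the vertex set $V=\{1,\dots,n\}$, so that a simple random walk on $G$ moves at each step to a vertex chosen uniformly from all of $V$ (the current vertex included), independently of the past. Fix $r\in V$. Aldous-Broder process: let $(X_t)_{t\ge 0}$ be a simple random walk on $G$ with $X_0=r$, let $V_t=\{X_0,\dots,X_t\}$ and let $\eta=\inf\{t: V_t=V\}$ be the cover time. Set $\sigma^{\rm in}_0=0$ and for $i\ge 1$ $$\sigma^{\rm out}_i=\inf\{t>\sigma^{\rm in}_{i-1}: X_t\notin V_{t-1}\}\wedge\eta,\qquad \sigma^{\rm in}_i=\inf\{t>\sigma^{\rm out}_i: X_t\in V_{t-1}\}\wedge\eta .$$ For a time $s$, let $T^{AB}_s$ be the tree with vertex set $V_s$ and edge set $\{\{X_t,X_{t+1}\}: t<s,\ X_{t+1}\ne X_k \text{ for all } k\le t\}$. Wilson process: start with $V_X=\{r\}$, $E_X=\varnothing$; while $V_X\ne V$, choose $v\in V\setminus V_X$ uniformly at random, run a simple random walk on $G$ from $v$ until it first visits $V_X$, and add to $(V_X,E_X)$ the vertices and edges of the chronological loop-erasure of this walk (one such iteration is called a branch). Let $\hat\sigma_i$ denote the (cumulative random-walk step) time at which the $i$-th iteration is completed, with $\hat\sigma_0=0$, and let $T^W_{\hat\sigma_i}$ be the tree $(V_X,E_X)$ at that time (if the algorithm terminates after fewer than $i$ iterations, $T^W_{\hat\sigma_i}$ is the final spanning tree). Then for every $i\ge 0$, $T^W_{\hat\sigma_i}$ and $T^{AB}_{\sigma^{\rm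 in}_i}$ have the same distribution as random labelled subgraphs of $G$.
   Context: Loop-erasure: loops are erased in chronological order as they are created by the walk. Equality in distribution is as random labelled trees on subsets of $V$ (labels matter, not just the shape). *)

theory Defs
  imports "HOL-Probability.Probability" "HOL-Library.Extended_Nat"
begin

text \<open>
  A labelled graph is a pair of a vertex set and a set of edges, an edge being the set of its
  endpoints. Trajectories of a walk are functions on the time set \<open>nat\<close>; times that may be infinite
  are of type \<open>enat\<close>, where the infimum of the empty set is \<open>\<infinity>\<close>.
\<close>

text \<open>
  Every vertex of \<open>V\<close> is a neighbour of every vertex of \<open>V\<close>, itself included, so the steps of the
  walk are uniform on \<open>V\<close> and independent of the past. The starting vertex has law \<open>\<mu>\<close>.
\<close>

definition random_walk :: "'a measure \<Rightarrow> 'v set \<Rightarrow> 'v pmf \<Rightarrow> (nat \<Rightarrow> 'a \<Rightarrow> 'v) \<Rightarrow> bool" where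
  "random_walk M V \<mu> X \<longleftrightarrow>
     prob_space M \<and>
     prob_space.indep_vars M (\<lambda>_. count_space V) X UNIV \<and>
     distr M (count_space UNIV) (X 0) = measure_pmf \<mu> \<and>
     (\<forall>t. distr M (count_space UNIV) (X (Suc t)) = measure_pmf (pmf_of_set V))"

definition visited :: "(nat \<Rightarrow> 'v) \<Rightarrow> enat \<Rightarrow> 'v set" where
  "visited x s = {x t | t. enat t \<le> s}"

definition cover_time :: "'v set \<Rightarrow> (nat \<Rightarrow> 'v) \<Rightarrow> enat" where
  "cover_time V x = Inf {enat t | t. visited x (enat t) = V}"

definition next_out :: "'v set \<Rightarrow> (nat \<Rightarrow> 'v) \<Rightarrow> enat \<Rightarrow> enat" where
  "next_out V x s =
     min (Inf {enat t | t. s < enat t \<and> x t \<notin> visited x (enat (t - 1))}) (cover_time V x)"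

definition next_in :: "'v set \<Rightarrow> (nat \<Rightarrow> 'v) \<Rightarrow> enat \<Rightarrow> enat" where
  "next_in V x s =
     min (Inf {enat t | t. s < enat t \<and> x t \<in> visited x (enat (t - 1))}) (cover_time V x)"

primrec sigma_in :: "'v set \<Rightarrow> (nat \<Rightarrow> 'v) \<Rightarrow> nat \<Rightarrow> enat" where
  "sigma_in V x 0 = 0"
| "sigma_in V x (Suc i) = next_in V x (next_out V x (sigma_in V x i))"

definition AB_tree :: "(nat \<Rightarrow> 'v) \<Rightarrow> enat \<Rightarrow> 'v set \<times> 'v set set" where
  "AB_tree x s =
     (visited x s,
      {{x t, x (Suc t)} | t. enat t < s \<and> (\<forall>k\<le>t. x (Suc t) \<noteq> x k)})"

text \<open>
  The argument \<open>p\<close> is the loop-erasure so far; stepping to a vertex \<open>v\<close> already on \<open>p\<close> closes a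
  loop, which is erased at once.
\<close>

definition loop_erasure_step :: "'v list \<Rightarrow> 'v \<Rightarrow> 'v list" where
  "loop_erasure_step p v = takeWhile (\<lambda>u. u \<noteq> v) p @ [v]"

definition loop_erasure :: "'v list \<Rightarrow> 'v list" where
  "loop_erasure w = foldl loop_erasure_step [] w"

definition path_edges :: "'v list \<Rightarrow> 'v set set" where
  "path_edges p = {{p ! k, p ! Suc k} | k. Suc k < length p}"

definition hitting_time :: "'v set \<Rightarrow> (nat \<Rightarrow> 'v) \<Rightarrow> enat" where
  "hitting_time S x = Inf {enat t | t. x t \<in> S}"

text \<open>
  The trajectory up to and including its first visit to \<open>S\<close>. The value for trajectories that never
  visit \<open>S\<close> is a dummy: in the Wilson process this has probability zero.
\<close>

definition stopped_walk :: "'v set \<Rightarrow> (nat \<Rightarrow> 'v) \<Rightarrow> 'v list" where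
  "stopped_walk S x =
     (case hitting_time S x of enat t \<Rightarrow> map x [0..<Suc t] | \<infinity> \<Rightarrow> [])"

definition add_branch :: "'v set \<times> 'v set set \<Rightarrow> 'v list \<Rightarrow> 'v set \<times> 'v set set" where
  "add_branch T w =
     (fst T \<union> set (loop_erasure w), snd T \<union> path_edges (loop_erasure w))"

text \<open>The graph \<open>(V\<^sub>X, E\<^sub>X)\<close> resulting from the list \<open>ws\<close> of stopped walks run so far.\<close>

definition wilson_graph :: "'v \<Rightarrow> 'v list list \<Rightarrow> 'v set \<times> 'v set set" where
  "wilson_graph r ws = foldl add_branch ({r}, {}) ws"

text \<open>
  Here \<open>y i\<close> is the trajectory available to iteration \<open>i + 1\<close>, starting at the vertex chosen in that
  iteration; it is not used if the algorithm has already terminated. \<open>wilson_walks V r y i\<close> records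
  the stopped walks of the first \<open>i\<close> iterations.
\<close>

primrec wilson_walks :: "'v set \<Rightarrow> 'v \<Rightarrow> (nat \<Rightarrow> nat \<Rightarrow> 'v) \<Rightarrow> nat \<Rightarrow> 'v list list" where
  "wilson_walks V r y 0 = []"
| "wilson_walks V r y (Suc i) =
     (let ws = wilson_walks V r y i; VX = fst (wilson_graph r ws)
      in if VX = V then ws else ws @ [stopped_walk VX (y i)])"

text \<open>
  The cumulative number of random walk steps when iteration \<open>i\<close> is completed, or when the algorithm
  terminated if there are fewer than \<open>i\<close> iterations.
\<close>

primrec wilson_time :: "'v set \<Rightarrow> 'v \<Rightarrow> (nat \<Rightarrow> nat \<Rightarrow> 'v) \<Rightarrow> nat \<Rightarrow> enat" where
  "wilson_time V r y 0 = 0"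
| "wilson_time V r y (Suc i) =
     (let VX = fst (wilson_graph r (wilson_walks V r y i))
      in if VX = V then wilson_time V r y i
         else wilson_time V r y i + hitting_time VX (y i))"

text \<open>
  The graph \<open>(V\<^sub>X, E\<^sub>X)\<close> at time \<open>s\<close>. Since \<open>V\<^sub>X\<close> and \<open>E\<^sub>X\<close> only grow, it is the union of the graphs
  obtained in the iterations completed by time \<open>s\<close>.
\<close>

definition wilson_tree ::
    "'v set \<Rightarrow> 'v \<Rightarrow> (nat \<Rightarrow> nat \<Rightarrow> 'v) \<Rightarrow> enat \<Rightarrow> 'v set \<times> 'v set set" where
  "wilson_tree V r y s =
     (\<Union>j\<in>{j. wilson_time V r y j \<le> s}. fst (wilson_graph r (wilson_walks V r y j)),
      \<Union>j\<in>{j. wilson_time V r y j \<le> s}. snd (wilson_graph r (wilson_walks V r y j)))"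

text \<open>
  Conditionally on the earlier iterations (and as long as \<open>V\<^sub>X \<noteq> V\<close>), the walk of the next iteration
  is a simple random walk started from a uniformly chosen vertex of \<open>V - V\<^sub>X\<close>. The stopped walks
  take countably many values, so conditioning on atoms of positive probability suffices.
\<close>

definition wilson_process ::
    "'a measure \<Rightarrow> 'v set \<Rightarrow> 'v \<Rightarrow> (nat \<Rightarrow> nat \<Rightarrow> 'a \<Rightarrow> 'v) \<Rightarrow> bool" where
  "wilson_process M V r Y \<longleftrightarrow>
     prob_space M \<and>
     (\<forall>i t. Y i t \<in> measurable M (count_space V)) \<and>
     (\<forall>i ws.
        let past = {\<omega> \<in> space M. wilson_walks V r (\<lambda>j t. Y j t \<omega>) i = ws};
            VX = fst (wilson_graph r ws)
        in measure M past > 0 \<and> VX \<noteq> V \<longrightarrow>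
             random_walk (uniform_measure M past) V (pmf_of_set (V - VX)) (Y i))"

end

theory Submission
  imports Defs
begin

text \<open>
  Both processes turn out to be the Markov chain of trees that is stopped once it covers \<open>V\<close> and
  otherwise attaches, to a uniform vertex of the current tree, a run of new vertices: the run starts
  at a uniform vertex outside the tree and is extended by uniform choices from \<open>V\<close> until a vertex of
  the tree or of the run is hit. For Aldous-Broder, the vertex attached to is uniform because the
  vertex that ends a run, and every vertex the walk moves to before it leaves the tree again, is
  uniform in the tree given the past. For Wilson, the loop-erased branch in the complete graph has
  the law of such a run and an independent uniform end point in the tree, but it is attached by its
  last vertex; this makes no difference since the mass of a run depends on its length only.

  Neither process is analysed along its stopping times. Instead, the conditional law of the final
  tree given the walk so far is guessed explicitly, and one only checks that it is a martingale.
\<close>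

text \<open>The self-loops make the guessed laws explicit: a step does not depend on the current
  vertex, so each prescribed new vertex of a run costs 1/n, and only the closing step sees the
  state, through the number of occupied vertices.

  The obstacle is that the past reveals too much. In Aldous-Broder the vertex to which the next
  branch is attached is the known current vertex, not a uniform one, so the guess has to depend on
  it; uniformity reappears only when the next return to the tree is averaged. In Wilson the whole
  current loop-erasure matters, since the walk may still fall back to any of its vertices.

  A one-step identity alone would not identify the law. What closes the argument is that the walk
  visits every vertex almost surely, so the guess eventually becomes the point mass at the tree
  actually built.\<close>

lemma bind_pmf_of_set_resample:
  assumes "finite V" and "A \<subseteq> V" and "A \<noteq> {}"
  shows "pmf_of_set V \<bind> (\<lambda>x. if x \<in> A then f x else g x) =
    pmf_of_set V \<bind> (\<lambda>x. if x \<in> A then pmf_of_set A \<bind> f else g x)"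
proof (rule pmf_eqI)
  fix c
  have fA: "finite A" using assms finite_subset by blast
  have V: "V \<noteq> {}" using assms by auto
  have *: "(\<Sum>x\<in>V. pmf (if x \<in> A then h x else g x) c) = (\<Sum>x\<in>A. pmf (h x) c) + (\<Sum>x\<in>V - A. pmf (g x) c)" for h
    by (subst sum.subset_diff[OF assms(2,1)]) (auto intro!: arg_cong2[where f="(+)"] sum.cong)
  \<comment> \<open>The inner draw contributes the mean of \<open>pmf (f x) c\<close> over
    \<open>A\<close>, and it does so \<open>card A\<close> times.\<close>
  have "(\<Sum>x\<in>A. pmf (pmf_of_set A \<bind> f) c) = (\<Sum>x\<in>A. pmf (f x) c)"
    using fA assms(3) by (simp add: pmf_bind integral_pmf_of_set)
  then show "pmf (pmf_of_set V \<bind> (\<lambda>x. if x \<in> A then f x else g x)) c =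
      pmf (pmf_of_set V \<bind> (\<lambda>x. if x \<in> A then pmf_of_set A \<bind> f else g x)) c"
    using V assms(1) by (simp add: pmf_bind integral_pmf_of_set *)
qed

text \<open>Rejection sampling: a uniform draw from \<open>V\<close> that is accepted is uniform in
  \<open>V - A\<close>, hence may be replaced by a fresh draw from there, and then both cases
  agree.\<close>

lemma bind_pmf_of_set_retry:
  assumes "finite V" and "A \<subset> V"
  shows "pmf_of_set V \<bind> (\<lambda>x. if x \<in> A then pmf_of_set (V - A) \<bind> f else f x) =
    pmf_of_set (V - A) \<bind> f"
proof -
  have V: "set_pmf (pmf_of_set V) = V"
    using assms by (intro set_pmf_of_set) auto
  have "pmf_of_set V \<bind> (\<lambda>x. if x \<in> A then pmf_of_set (V - A) \<bind> f else f x) =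
    pmf_of_set V \<bind> (\<lambda>x. if x \<in> V - A then f x else pmf_of_set (V - A) \<bind> f)"
    using V by (intro bind_pmf_cong) auto
  also have "\<dots> = pmf_of_set V \<bind> (\<lambda>x. if x \<in> V - A then pmf_of_set (V - A) \<bind> f
      else pmf_of_set (V - A) \<bind> f)"
    using assms by (intro bind_pmf_of_set_resample) auto
  finally show ?thesis by (simp cong: if_cong)
qed

lemma path_edges_Cons_Cons [simp]: "path_edges (u # v # p) = insert {u, v} (path_edges (v # p))"
proof -
  have "{k. Suc k < length (u # v # p)} = insert 0 (Suc ` {k. Suc k < length (v # p)})"
    by (auto simp: image_iff) (metis not0_implies_Suc Suc_less_eq)
  then have "(\<lambda>k. {(u # v # p) ! k, (u # v # p) ! Suc k}) ` {k. Suc k < length (u # v # p)} =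
    insert {u, v} ((\<lambda>k. {(v # p) ! k, (v # p) ! Suc k}) ` {k. Suc k < length (v # p)})"
    by (simp add: image_image)
  then show ?thesis unfolding path_edges_def by (simp add: image_def setcompr_eq_image)
qed

lemma path_edges_simps [simp]: "path_edges [] = {}" "path_edges [u] = {}"
  by (auto simp: path_edges_def)

lemma path_edges_snoc: "path_edges (p @ [u, v]) = insert {u, v} (path_edges (p @ [u]))"
  by (induction p rule: induct_list012) auto

lemma path_edges_rev [simp]: "path_edges (rev p) = path_edges p"
  by (induction p rule: induct_list012) (auto simp: path_edges_snoc)

lemma loop_erasure_step_neq_Nil [simp]: "loop_erasure_step p x \<noteq> []"
  by (simp add: loop_erasure_step_def)

section \<open>Runs of new vertices and the Markov chain of trees\<close>

locale finite_vertex_set =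
  fixes V :: "'v::countable set"
  assumes finite_V: "finite V" and V_nonempty: "V \<noteq> {}"
begin

abbreviation unif :: "'v pmf" where "unif \<equiv> pmf_of_set V"

lemma set_unif [simp]: "set_pmf unif = V"
  using finite_V V_nonempty by simp

text \<open>Vertices of the run are inserted into \<open>A\<close>, so that a single set describes
  everything that can stop it. The stopping vertex is not recorded; its law is supplied separately,
  by resampling in Aldous-Broder and by an independent uniform end point in Wilson.\<close>

function fresh_run :: "'v set \<Rightarrow> 'v list pmf" where
  "fresh_run A = unif \<bind> (\<lambda>x. if x \<in> A then return_pmf [] else map_pmf ((#) x) (fresh_run (insert x A)))"
  by auto
termination
proof (relation "Wellfounded.measure (\<lambda>A. card (V - A))")
  fix A x
  assume "x \<in> set_pmf unif" "x \<notin> A"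
  then have "card (V - insert x A) < card (V - A)"
    using finite_V by (intro psubset_card_mono) auto
  then show "(insert x A, A) \<in> Wellfounded.measure (\<lambda>A. card (V - A))"
    by simp
qed simp

declare fresh_run.simps [simp del]

text \<open>Each prescribed new vertex has probability 1/n, and the closing step may go to any of
  the \<open>card A + length q\<close> vertices occupied by then.\<close>

lemma pmf_fresh_run:
  assumes "A \<subseteq> V"
  shows "pmf (fresh_run A) q =
    (if distinct q \<and> set q \<subseteq> V - A then real (card A + length q) / real (card V) ^ Suc (length q) else 0)"
  using assms
proof (induction q arbitrary: A)
  case Nil
  have "pmf (if x \<in> A then return_pmf [] else map_pmf ((#) x) (fresh_run (insert x A))) [] =
      indicator A x" for x
    by (simp add: pmf_map vimage_def)
  then have "pmf (fresh_run A) [] = card A / card V"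
    using finite_V V_nonempty Nil
    by (subst fresh_run.simps) (simp add: pmf_bind measure_pmf_of_set Int_absorb1)
  then show ?case by simp
next
  case (Cons y q)
  have eq: "pmf (if x \<in> A then return_pmf [] else map_pmf ((#) x) (fresh_run (insert x A))) (y # q) =
     (if x = y then if y \<in> A then 0 else pmf (fresh_run (insert y A)) q else 0)" for x
  proof (cases "x = y")
    case True
    then show ?thesis using pmf_map_inj'[of "(#) y" "fresh_run (insert y A)" q] by auto
  next
    case False
    then have "(y # q) \<notin> set_pmf (map_pmf ((#) x) (fresh_run (insert x A)))" by auto
    then have "pmf (map_pmf ((#) x) (fresh_run (insert x A))) (y # q) = 0"
      by (simp only: set_pmf_iff not_not)
    then show ?thesis using False by simp
  qed
  have "pmf (fresh_run A) (y # q) =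
     (if y \<in> V - A then pmf (fresh_run (insert y A)) q else 0) / card V"
    using finite_V V_nonempty
    by (subst fresh_run.simps) (simp add: pmf_bind integral_pmf_of_set eq)
  moreover have "card (insert y A) = Suc (card A)" if "y \<in> V - A"
    using that Cons.prems finite_V finite_subset by (metis DiffD2 card_insert_disjoint)
  ultimately show ?case
    using Cons.IH[of "insert y A"] Cons.prems by auto
qed

lemma fresh_run_full: "fresh_run V = return_pmf []"
proof -
  have "fresh_run V = unif \<bind> (\<lambda>x. return_pmf [])"
    by (subst fresh_run.simps) (rule bind_pmf_cong, auto)
  then show ?thesis by simp
qed

text \<open>This is a run conditioned to be nonempty.\<close>

definition branch :: "'v set \<Rightarrow> 'v list pmf" where
  "branch A = pmf_of_set (V - A) \<bind> (\<lambda>v. map_pmf ((#) v) (fresh_run (insert v A)))"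

text \<open>The first vertex costs \<open>1 / card (V - A)\<close> instead of 1/n. The remaining
  vertices and the closing step together give the power \<open>length p\<close> of n.\<close>

lemma pmf_branch:
  assumes "A \<subset> V"
  shows "pmf (branch A) p =
    (if p \<noteq> [] \<and> distinct p \<and> set p \<subseteq> V - A
     then real (card A + length p) / (real (card (V - A)) * real (card V) ^ length p) else 0)"
proof (cases p)
  case Nil
  then have "p \<notin> set_pmf (branch A)" by (auto simp: branch_def)
  then show ?thesis using Nil by (simp only: set_pmf_iff) simp
next
  case (Cons y q)
  have eq: "pmf (map_pmf ((#) x) (fresh_run (insert x A))) (y # q) =
     (if x = y then pmf (fresh_run (insert y A)) q else 0)" for x
  proof (cases "x = y")
    case True
    then show ?thesis using pmf_map_inj'[of "(#) y" "fresh_run (insert y A)" q] by auto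
  next
    case False
    then have "(y # q) \<notin> set_pmf (map_pmf ((#) x) (fresh_run (insert x A)))" by auto
    then have "pmf (map_pmf ((#) x) (fresh_run (insert x A))) (y # q) = 0"
      by (simp only: set_pmf_iff not_not)
    then show ?thesis using False by simp
  qed
  have fA: "finite (V - A)" "V - A \<noteq> {}" using assms finite_V by auto
  have "pmf (branch A) (y # q) = (if y \<in> V - A then pmf (fresh_run (insert y A)) q else 0) / card (V - A)"
    using fA unfolding branch_def by (simp add: pmf_bind integral_pmf_of_set eq)
  moreover have "card (insert y A) = Suc (card A)" if "y \<in> V - A"
    using that assms finite_V finite_subset by (metis DiffD2 card_insert_disjoint psubset_imp_subset)
  ultimately show ?thesis
    using pmf_fresh_run[of "insert y A" q] assms Cons by auto
qed

text \<open>The mass of a path under \<^term>\<open>branch A\<close> depends on its length only.\<close>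

lemma map_rev_branch:
  assumes "A \<subset> V"
  shows "map_pmf rev (branch A) = branch A"
proof (rule pmf_eqI)
  fix p
  have "pmf (map_pmf rev (branch A)) (rev (rev p)) = pmf (branch A) (rev p)"
    by (rule pmf_map_inj') (simp add: inj_on_def)
  then show "pmf (map_pmf rev (branch A)) p = pmf (branch A) p"
    by (simp add: pmf_branch[OF assms])
qed

definition attach :: "'v set \<times> 'v set set \<Rightarrow> 'v \<Rightarrow> 'v list \<Rightarrow> 'v set \<times> 'v set set" where
  "attach T u p = (fst T \<union> set p, snd T \<union> path_edges (u # p))"

definition grow :: "'v set \<times> 'v set set \<Rightarrow> ('v set \<times> 'v set set) pmf" where
  "grow T = (if fst T = V then return_pmf T
     else pmf_of_set (fst T) \<bind> (\<lambda>u. map_pmf (attach T u) (branch (fst T))))"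

primrec trees :: "nat \<Rightarrow> 'v set \<times> 'v set set \<Rightarrow> ('v set \<times> 'v set set) pmf" where
  "trees 0 T = return_pmf T"
| "trees (Suc i) T = grow T \<bind> trees i"

text \<open>The definition splits off the first step, which suits the Aldous-Broder law as a view of
  the future; Wilson's induction adds the newest branch last.\<close>

lemma trees_Suc': "trees (Suc i) T = trees i T \<bind> grow"
proof (induction i arbitrary: T)
  case 0
  have "trees 0 = return_pmf" by (simp add: fun_eq_iff)
  then show ?case by (simp add: bind_return_pmf bind_return_pmf')
next
  case (Suc i)
  have "trees (Suc (Suc i)) T = grow T \<bind> (\<lambda>T. trees i T \<bind> grow)"
    unfolding trees.simps(2)[of "Suc i"] by (rule bind_pmf_cong[OF refl Suc.IH])
  then show ?case by (simp add: bind_assoc_pmf)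
qed

lemma trees_full: "fst T = V \<Longrightarrow> trees i T = return_pmf T"
  by (induction i) (simp_all add: grow_def bind_return_pmf)

lemma attach_Cons: "attach T u (x # p) = attach (attach T u [x]) x p"
  by (simp add: attach_def insert_commute)

lemma attach_Nil [simp]: "attach T u [] = T"
  by (simp add: attach_def)

section \<open>Wilson's branches\<close>

text \<open>The guess for the loop-erasure of a walk from \<open>v\<close> stopped in
  \<open>S\<close>, split into the path before the end point and the end point. Their independence
  is part of the guess.\<close>

definition erased_walk :: "'v set \<Rightarrow> 'v \<Rightarrow> ('v list \<times> 'v) pmf" where
  "erased_walk S v = pair_pmf (map_pmf ((#) v) (fresh_run (insert v S))) (pmf_of_set S)"

text \<open>The walk from \<open>v\<close> makes its first step; if it moves to a new vertex \<open>x\<close>, it is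
  loop-erased up to its first visit to \<open>insert v S\<close>.\<close>

lemma erased_walk_step:
  assumes S: "S \<subset> V" "S \<noteq> {}" and v: "v \<in> V - S"
  shows "erased_walk S v = unif \<bind> (\<lambda>x. if x \<in> S then return_pmf ([v], x)
     else if x = v then erased_walk S v
     else erased_walk (insert v S) x \<bind>
       (\<lambda>(q, u). if u = v then erased_walk S v else return_pmf (v # q, u)))"
    (is "_ = unif \<bind> ?f")
proof (rule pmf_eqI)
  fix qu :: "'v list \<times> 'v"
  obtain q u where qu: "qu = (q, u)" by force
  have fS: "finite S" using assms finite_V finite_subset by blast
  have cS: "card S > 0" using fS S by (simp add: card_gt_0_iff)
  \<comment> \<open>The mass \<open>c\<close> at a fixed value occurs on both sides, because every
    return to \<open>v\<close> starts the walk afresh. The identity is thus a linear equation for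
    \<open>c\<close>.\<close>
  define k c n where "k = real (card S)" and "c = pmf (erased_walk S v) (q, u)"
    and "n = real (card V)"
  have k: "k > 0" using cS by (simp add: k_def)
  have "card S < card V" using S finite_V by (simp add: psubset_card_mono)
  then have n: "n > 0" by (simp add: n_def)
  define b where "b x = pmf (map_pmf ((#) v \<circ> (#) x) (fresh_run (insert x (insert v S)))) q" for x
  define d where "d = (if q = [v] then 1 else 0 :: real)"
  \<comment> \<open>The walk from \<open>x\<close> ends uniformly in the \<open>k + 1\<close>
    vertices of \<open>insert v S\<close>. Ending at \<open>v\<close> erases the whole loop and
    leaves mass \<open>c\<close>; ending at \<open>u\<close> in \<open>S\<close> keeps the path,
    with mass \<open>b x\<close>.\<close>
  have 3: "pmf (erased_walk (insert v S) x \<bind>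
       (\<lambda>(q, u). if u = v then erased_walk S v else return_pmf (v # q, u))) (q, u) =
      c / (k + 1) + (if u \<in> S then b x / (k + 1) else 0)" for x
  proof -
    have "erased_walk (insert v S) x \<bind>
       (\<lambda>(q, u). if u = v then erased_walk S v else return_pmf (v # q, u)) =
      pmf_of_set (insert v S) \<bind> (\<lambda>u. if u = v then erased_walk S v
        else map_pmf (\<lambda>q. (q, u)) (map_pmf ((#) v \<circ> (#) x) (fresh_run (insert x (insert v S)))))"
      unfolding erased_walk_def pair_pmf_def
      by (subst bind_commute_pmf)
        (auto simp: bind_assoc_pmf bind_return_pmf map_pmf_def intro!: bind_pmf_cong)
    moreover have "pmf (map_pmf (\<lambda>q. (q, w)) (map_pmf ((#) v \<circ> (#) x)
        (fresh_run (insert x (insert v S))))) (q, u) = (if w = u then b x else 0)" for w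
      using pmf_map_inj'[of "\<lambda>q. (q, u)" _ q] unfolding b_def
      by (auto simp: inj_on_def intro!: pmf_map_outside)
    moreover have "(\<Sum>w\<in>S. pmf (if w = v then erased_walk S v else map_pmf (\<lambda>q. (q, w))
        (map_pmf ((#) v \<circ> (#) x) (fresh_run (insert x (insert v S))))) (q, u)) =
        (\<Sum>w\<in>S. if w = u then b x else 0)"
      using v calculation(2) by (intro sum.cong) auto
    ultimately show ?thesis
      using v fS by (simp add: pmf_bind integral_pmf_of_set c_def k_def add_divide_distrib add.commute)
  qed
  have f: "pmf (?f x) (q, u) = (if x \<in> S then d * (if x = u then 1 else 0)
     else if x = v then c else c / (k + 1) + (if u \<in> S then b x / (k + 1) else 0))" for x
    using 3 by (auto simp: c_def d_def)
  have V: "V = S \<union> insert v (V - insert v S)" using S v by auto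
  define B where "B = (\<Sum>x\<in>V - insert v S. b x)"
  have cV: "real (card (V - insert v S)) = n - k - 1"
    using v S fS finite_V
    by (auto simp: card_Diff_subset n_def k_def card_insert_if of_nat_diff psubset_imp_subset Suc_leI psubset_card_mono)
  have "(\<Sum>x\<in>V. pmf (?f x) (q, u)) =
      (\<Sum>x\<in>S. d * (if x = u then 1 else 0)) + (c + (\<Sum>x\<in>V - insert v S. c / (k + 1) +
        (if u \<in> S then b x / (k + 1) else 0)))"
    unfolding f
    apply (subst V)
    apply (subst sum.union_disjoint)
    using v fS finite_V by (auto intro!: arg_cong2[where f="(+)"] sum.cong)
  also have "\<dots> = (if u \<in> S then d else 0) + c + (n - k - 1) * (c / (k + 1)) +
      (if u \<in> S then B / (k + 1) else 0)"
    using fS by (simp add: sum.distrib cV B_def sum_divide_distrib sum_distrib_left[symmetric])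
  finally have R: "pmf (unif \<bind> ?f) (q, u) = ((if u \<in> S then d else 0) + c + (n - k - 1) * (c / (k + 1)) +
      (if u \<in> S then B / (k + 1) else 0)) / n"
    using finite_V V_nonempty by (simp add: pmf_bind integral_pmf_of_set n_def)
  \<comment> \<open>Direct computation from the definition: \<open>k + 1\<close> first steps stop
    the run at once, and the independent end point contributes the factor
    \<open>1 / k\<close>.\<close>
  have L: "c = (if u \<in> S then ((k + 1) * d + B) / (n * k) else 0)"
  proof -
    have step: "pmf (map_pmf ((#) v) (if x \<in> insert v S then return_pmf []
        else map_pmf ((#) x) (fresh_run (insert x (insert v S))))) q =
      (if x \<in> insert v S then d else b x)" for x
      by (simp add: d_def b_def pmf.map_comp)
    have "pmf (map_pmf ((#) v) (fresh_run (insert v S))) q =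
      (\<Sum>x\<in>V. if x \<in> insert v S then d else b x) / n"
      using finite_V V_nonempty
      by (subst fresh_run.simps) (simp only: map_bind_pmf pmf_bind integral_pmf_of_set[OF V_nonempty finite_V] step n_def)
    also have "(\<Sum>x\<in>V. if x \<in> insert v S then d else b x) = (k + 1) * d + B"
      apply (subst V)
      apply (subst sum.union_disjoint)
      using v fS finite_V by (auto simp: B_def k_def algebra_simps intro!: sum.cong)
    finally show ?thesis
      using fS S by (simp add: c_def erased_walk_def pmf_pair k_def)
  qed
  \<comment> \<open>For \<open>u\<close> in \<open>S\<close>, multiplying the required equation by
    \<open>n * (k + 1)\<close> and cancelling \<open>n * c\<close> leaves
    \<open>n * k * c = (k + 1) * d + B\<close>, which is \<open>L\<close>. Otherwise
    \<open>c = 0\<close> and both sides vanish.\<close>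
  show "pmf (erased_walk S v) qu = pmf (unif \<bind> ?f) qu"
    unfolding qu R c_def[symmetric]
    using L k n by (auto simp: divide_simps) (simp_all add: algebra_simps)?
qed

text \<open>The law of the final loop-erasure, split into its interior and its end point in \<open>S\<close>,
  given the current loop-erasure \<open>p\<close>. Whether the walk ever returns to the first vertex of
  \<open>p\<close> is decided by the loop-erasure stopped at that vertex or in \<open>S\<close>.\<close>

fun resume :: "'v set \<Rightarrow> 'v list \<Rightarrow> ('v list \<times> 'v) pmf" where
  "resume S [] = undefined"
| "resume S [v] = erased_walk S v"
| "resume S (v # w # p) = resume (insert v S) (w # p) \<bind>
     (\<lambda>(q, u). if u = v then erased_walk S v else return_pmf (v # q, u))"

lemma resume_Cons:
  "p \<noteq> [] \<Longrightarrow> resume S (v # p) = resume (insert v S) p \<bind>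
     (\<lambda>(q, u). if u = v then erased_walk S v else return_pmf (v # q, u))"
  by (cases p) auto

text \<open>Induction moves the first vertex \<open>v\<close> of the loop-erasure into the target
  set. A step to \<open>v\<close> is then a hit of the inner problem and a restart at
  \<open>v\<close> of the outer one, just as the erasure cuts the path back to \<open>[v]\<close>; a
  step to any other vertex outside \<open>S\<close> leaves \<open>v\<close> in front of the erased
  path.\<close>

lemma resume_step:
  assumes "p \<noteq> []" and "distinct p" and "set p \<subseteq> V - S" and "S \<noteq> {}" and "S \<subseteq> V"
  shows "resume S p = unif \<bind> (\<lambda>x. if x \<in> S then return_pmf (p, x)
    else resume S (loop_erasure_step p x))"
  using assms
proof (induction S p rule: resume.induct)
  case (2 S v)
  then have "S \<subset> V" "v \<in> V - S" by auto
  from erased_walk_step[OF this(1) \<open>S \<noteq> {}\<close> this(2)]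
  have "erased_walk S v = unif \<bind> (\<lambda>x. if x \<in> S then return_pmf ([v], x)
     else if x = v then erased_walk S v
     else erased_walk (insert v S) x \<bind>
       (\<lambda>(q, u). if u = v then erased_walk S v else return_pmf (v # q, u)))" .
  also have "\<dots> = unif \<bind> (\<lambda>x. if x \<in> S then return_pmf ([v], x)
    else resume S (loop_erasure_step [v] x))"
    by (intro bind_pmf_cong) (auto simp: loop_erasure_step_def)
  finally show ?case by simp
next
  case (3 S v w p)
  have IH: "resume (insert v S) (w # p) = unif \<bind> (\<lambda>x. if x \<in> insert v S then return_pmf (w # p, x)
    else resume (insert v S) (loop_erasure_step (w # p) x))"
    using 3 by auto
  have "resume S (v # w # p) = unif \<bind> (\<lambda>x. (if x \<in> insert v S then return_pmf (w # p, x)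
    else resume (insert v S) (loop_erasure_step (w # p) x)) \<bind>
     (\<lambda>(q, u). if u = v then erased_walk S v else return_pmf (v # q, u)))"
    by (simp only: resume.simps IH bind_assoc_pmf)
  also have "\<dots> = unif \<bind> (\<lambda>x. if x \<in> S then return_pmf (v # w # p, x)
    else resume S (loop_erasure_step (v # w # p) x))"
  proof (rule bind_pmf_cong[OF refl])
    fix x
    consider "x \<in> S" | "x = v" "x \<notin> S" | "x \<noteq> v" "x \<notin> S" by blast
    then show "(if x \<in> insert v S then return_pmf (w # p, x)
        else resume (insert v S) (loop_erasure_step (w # p) x)) \<bind>
       (\<lambda>(q, u). if u = v then erased_walk S v else return_pmf (v # q, u)) =
      (if x \<in> S then return_pmf (v # w # p, x) else resume S (loop_erasure_step (v # w # p) x))"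
    proof cases
      case 1
      then have "x \<noteq> v" using 3 by auto
      with 1 show ?thesis by (simp add: bind_return_pmf)
    next
      case 2
      then show ?thesis by (simp add: bind_return_pmf loop_erasure_step_def)
    next
      case 3
      then have "loop_erasure_step (v # w # p) x = v # loop_erasure_step (w # p) x"
        by (simp add: loop_erasure_step_def)
      then show ?thesis using 3 by (simp add: resume_Cons)
    qed
  qed
  finally show ?case .
qed simp

end

section \<open>Loop-erasure and stopping of finite walks\<close>

lemma loop_erasure_snoc: "loop_erasure (w @ [x]) = loop_erasure_step (loop_erasure w) x"
  by (simp add: loop_erasure_def)

lemma set_loop_erasure: "set (loop_erasure w) \<subseteq> set w"
  by (induction w rule: rev_induct)
    (auto simp: loop_erasure_snoc loop_erasure_step_def loop_erasure_def dest: set_takeWhileD)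

lemma distinct_loop_erasure: "distinct (loop_erasure w)"
proof (induction w rule: rev_induct)
  case (snoc x w)
  then show ?case
    by (auto simp: loop_erasure_snoc loop_erasure_step_def dest: set_takeWhileD)
qed (simp add: loop_erasure_def)

lemma loop_erasure_eq_Nil [simp]: "loop_erasure w = [] \<longleftrightarrow> w = []"
  by (cases w rule: rev_cases) (simp_all add: loop_erasure_snoc, simp add: loop_erasure_def)

lemma loop_erasure_snoc_new: "x \<notin> set w \<Longrightarrow> loop_erasure (w @ [x]) = loop_erasure w @ [x]"
  using set_loop_erasure[of w]
  by (auto simp: loop_erasure_snoc loop_erasure_step_def takeWhile_eq_all_conv[THEN iffD2])

text \<open>Counterpart of \<open>stopped_walk\<close> on finite prefixes, since the martingale is
  evaluated on prefixes only. Once \<open>S\<close> is hit it no longer changes as the prefix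
  grows.\<close>

definition stopped_list :: "'v set \<Rightarrow> 'v list \<Rightarrow> 'v list" where
  "stopped_list S w = takeWhile (\<lambda>x. x \<notin> S) w @ take 1 (dropWhile (\<lambda>x. x \<notin> S) w)"

lemma stopped_list_append:
  "set u \<inter> S = {} \<Longrightarrow> x \<in> S \<Longrightarrow> stopped_list S (u @ x # w) = u @ [x]"
  by (induction u) (auto simp: stopped_list_def)

lemma stopped_list_snoc:
  "set w \<inter> S \<noteq> {} \<Longrightarrow> stopped_list S (w @ [x]) = stopped_list S w"
  by (induction w) (auto simp: stopped_list_def)

lemma stopped_walk_eq:
  assumes "\<exists>s\<le>t. x s \<in> S"
  shows "stopped_walk S x = stopped_list S (map x [0..<Suc t])"
proof -
  define h where "h = (LEAST s. x s \<in> S)"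
  obtain s where s: "s \<le> t" "x s \<in> S" using assms by blast
  have h: "x h \<in> S" unfolding h_def by (rule LeastI[of "\<lambda>s. x s \<in> S", OF s(2)])
  have "h \<le> s" unfolding h_def by (rule Least_le[of "\<lambda>s. x s \<in> S", OF s(2)])
  with s have ht: "h \<le> t" by simp
  have min: "x s \<notin> S" if "s < h" for s
    using not_less_Least[of s "\<lambda>s. x s \<in> S"] that unfolding h_def by blast
  have "hitting_time S x = enat h"
    unfolding hitting_time_def
  proof (rule Inf_eqI)
    fix i assume "i \<in> {enat t |t. x t \<in> S}"
    then show "enat h \<le> i" using min by (auto simp: not_less[symmetric])
  next
    fix y assume "\<And>i. i \<in> {enat t |t. x t \<in> S} \<Longrightarrow> y \<le> i"
    then show "y \<le> enat h" using h by auto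
  qed
  then have "stopped_walk S x = map x [0..<h] @ [x h]"
    by (simp add: stopped_walk_def)
  moreover have "map x [0..<Suc t] = map x [0..<h] @ x h # map x [Suc h..<Suc t]"
  proof -
    have "[0..<Suc t] = [0..<h] @ [h..<Suc t]"
      using ht upt_add_eq_append[of 0 h "Suc t - h"] by simp
    also have "[h..<Suc t] = h # [Suc h..<Suc t]" using ht by (simp add: upt_conv_Cons)
    finally show ?thesis by simp
  qed
  moreover have "set (map x [0..<h]) \<inter> S = {}" using min by auto
  ultimately show ?thesis
    using h by (simp only: stopped_list_append)
qed

context finite_vertex_set
begin

text \<open>Conditional law of the tree after the current branch, given the prefix \<open>l\<close>
  of its walk. Before the tree is hit it depends on \<open>l\<close> through the loop-erasure only;
  afterwards it is frozen at the outcome.\<close>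

definition wilson_law :: "'v set \<times> 'v set set \<Rightarrow> 'v list \<Rightarrow> ('v set \<times> 'v set set) pmf" where
  "wilson_law T l = (if set l \<inter> fst T \<noteq> {} then return_pmf (add_branch T (stopped_list (fst T) l))
     else map_pmf (\<lambda>(q, u). (fst T \<union> set (q @ [u]), snd T \<union> path_edges (q @ [u])))
       (resume (fst T) (loop_erasure l)))"

lemma wilson_law_step:
  assumes "fst T \<noteq> {}" "fst T \<subseteq> V" "l \<noteq> []" "set l \<subseteq> V"
  shows "wilson_law T l = unif \<bind> (\<lambda>x. wilson_law T (l @ [x]))"
proof (cases "set l \<inter> fst T = {}")
  case False
  then show ?thesis by (simp add: wilson_law_def stopped_list_snoc Int_Un_distrib2)
next
  case True
  have "resume (fst T) (loop_erasure l) = unif \<bind> (\<lambda>x. if x \<in> fst T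
      then return_pmf (loop_erasure l, x)
      else resume (fst T) (loop_erasure_step (loop_erasure l) x))"
    using assms True set_loop_erasure[of l] distinct_loop_erasure[of l]
    by (intro resume_step) auto
  then have "wilson_law T l = unif \<bind> (\<lambda>x. map_pmf
      (\<lambda>(q, u). (fst T \<union> set (q @ [u]), snd T \<union> path_edges (q @ [u])))
      (if x \<in> fst T then return_pmf (loop_erasure l, x)
      else resume (fst T) (loop_erasure_step (loop_erasure l) x)))"
    using True by (simp add: wilson_law_def map_bind_pmf)
  also have "\<dots> = unif \<bind> (\<lambda>x. wilson_law T (l @ [x]))"
  proof (rule bind_pmf_cong[OF refl])
    fix x
    \<comment> \<open>The walk has avoided the tree so far, so the hitting vertex closes no loop and
      is appended to the loop-erasure.\<close>
    have "add_branch T (l @ [x]) = (fst T \<union> set (loop_erasure l @ [x]),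
        snd T \<union> path_edges (loop_erasure l @ [x]))" if "x \<in> fst T"
    proof -
      have "x \<notin> set l" using that True by auto
      then show ?thesis by (simp add: add_branch_def loop_erasure_snoc_new)
    qed
    then show "map_pmf (\<lambda>(q, u). (fst T \<union> set (q @ [u]), snd T \<union> path_edges (q @ [u])))
      (if x \<in> fst T then return_pmf (loop_erasure l, x)
      else resume (fst T) (loop_erasure_step (loop_erasure l) x)) = wilson_law T (l @ [x])"
      using True stopped_list_append[of l "fst T" x "[]"]
      by (auto simp: wilson_law_def loop_erasure_snoc)
  qed
  finally show ?thesis .
qed

text \<open>The end point is independent of the rest, so it can be drawn first; reversing the
  branch, which preserves its law, then attaches it by its first vertex as \<open>grow\<close>
  does.\<close>

lemma wilson_law_start:
  assumes "fst T \<noteq> {}" "fst T \<subset> V"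
  shows "pmf_of_set (V - fst T) \<bind> (\<lambda>v. wilson_law T [v]) = grow T"
proof -
  let ?S = "fst T"
  have fS: "finite ?S" and fVS: "finite (V - ?S)" "V - ?S \<noteq> {}"
    using assms finite_V finite_subset by auto
  have "pmf_of_set (V - ?S) \<bind> (\<lambda>v. wilson_law T [v]) =
     pmf_of_set (V - ?S) \<bind> (\<lambda>v. erased_walk ?S v \<bind>
       (\<lambda>(q, u). return_pmf (?S \<union> set (q @ [u]), snd T \<union> path_edges (q @ [u]))))"
    using fVS by (intro bind_pmf_cong)
      (auto simp: wilson_law_def loop_erasure_def loop_erasure_step_def map_pmf_def case_prod_unfold)
  also have "\<dots> = branch ?S \<bind> (\<lambda>p. pmf_of_set ?S \<bind> (\<lambda>u.
       return_pmf (?S \<union> set (p @ [u]), snd T \<union> path_edges (p @ [u]))))"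
    by (simp add: branch_def erased_walk_def pair_pmf_def bind_assoc_pmf bind_return_pmf map_pmf_def)
  also have "\<dots> = pmf_of_set ?S \<bind> (\<lambda>u. branch ?S \<bind> (\<lambda>p.
       return_pmf (?S \<union> set (p @ [u]), snd T \<union> path_edges (p @ [u]))))"
    by (rule bind_commute_pmf)
  also have "\<dots> = pmf_of_set ?S \<bind> (\<lambda>u. map_pmf rev (branch ?S) \<bind> (\<lambda>p.
       return_pmf (?S \<union> set (p @ [u]), snd T \<union> path_edges (p @ [u]))))"
    using assms by (simp add: map_rev_branch)
  also have "\<dots> = pmf_of_set ?S \<bind> (\<lambda>u. map_pmf (attach T u) (branch ?S))"
  proof (rule bind_pmf_cong[OF refl])
    fix u assume "u \<in> set_pmf (pmf_of_set ?S)"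
    then have "u \<in> ?S" using fS assms by simp
    then have "(?S \<union> set (rev p @ [u]), snd T \<union> path_edges (rev p @ [u])) = attach T u p" for p
      using path_edges_rev[of "u # p"] by (auto simp: attach_def)
    then show "map_pmf rev (branch ?S) \<bind> (\<lambda>p.
       return_pmf (?S \<union> set (p @ [u]), snd T \<union> path_edges (p @ [u]))) =
       map_pmf (attach T u) (branch ?S)"
      by (simp add: map_pmf_def bind_assoc_pmf bind_return_pmf)
  qed
  also have "\<dots> = grow T" using assms by (auto simp: grow_def)
  finally show ?thesis .
qed

end

section \<open>The Aldous-Broder exploration\<close>

context finite_vertex_set
begin

text \<open>A state consists of the current tree and vertex, of whether the last step was to a new
  vertex, and of the number of branches still to be completed.\<close>

type_synonym 'w exploration = "('w set \<times> 'w set set) \<times> 'w \<times> bool \<times> nat"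

text \<open>A step into the tree completes a branch only if it ends a run of new vertices, hence the
  test of \<open>g\<close>. Freezing a covering tree mirrors the minimum with the cover
  time.\<close>

fun explore :: "'v exploration \<Rightarrow> 'v \<Rightarrow> 'v exploration" where
  "explore (T, u, g, j) x =
     (if j = 0 \<or> fst T = V then (T, u, g, j)
      else if x \<in> fst T then (T, x, False, if g then j - 1 else j)
      else (attach T u [x], x, True, j))"

text \<open>The walk is at \<open>u\<close>, in the middle of a run that has yet to be finished;
  \<open>j\<close> further branches follow it.\<close>

definition run_law :: "nat \<Rightarrow> 'v set \<times> 'v set set \<Rightarrow> 'v \<Rightarrow> ('v set \<times> 'v set set) pmf" where
  "run_law j T u = fresh_run (fst T) \<bind> (\<lambda>p. trees j (attach T u p))"

text \<open>The known vertex \<open>u\<close> matters for the very next step only: a step into the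
  tree makes the current vertex uniform there, and the future is then that of the tree
  chain.\<close>

definition wait_law :: "nat \<Rightarrow> 'v set \<times> 'v set set \<Rightarrow> 'v \<Rightarrow> ('v set \<times> 'v set set) pmf" where
  "wait_law j T u = unif \<bind> (\<lambda>x. if x \<in> fst T then trees (Suc j) T else run_law j (attach T u [x]) x)"

text \<open>Here \<open>j\<close> counts the branch in progress or awaited, whereas
  \<open>run_law\<close> and \<open>wait_law\<close> count only the branches after it.\<close>

fun exploration_law :: "'v exploration \<Rightarrow> ('v set \<times> 'v set set) pmf" where
  "exploration_law (T, u, g, j) =
     (if j = 0 \<or> fst T = V then return_pmf T
      else if g then run_law (j - 1) T u else wait_law (j - 1) T u)"

lemma fst_attach_single [simp]: "fst (attach T u [x]) = insert x (fst T)"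
  by (simp add: attach_def)

lemma run_law_full: "fst T = V \<Longrightarrow> run_law j T u = return_pmf T"
  by (simp add: run_law_def fresh_run_full bind_return_pmf trees_full)

lemma run_law_step:
  "run_law j T u = unif \<bind> (\<lambda>x. if x \<in> fst T then trees j T else run_law j (attach T u [x]) x)"
  unfolding run_law_def
  by (subst fresh_run.simps, unfold bind_assoc_pmf, rule bind_pmf_cong[OF refl])
    (auto simp: bind_return_pmf bind_map_pmf attach_Cons[symmetric] intro!: bind_pmf_cong)

text \<open>The uniform vertex to which \<open>grow\<close> attaches is the current vertex of the
  walk, and a step inside the tree is a rejected draw. So \<open>bind_pmf_of_set_retry\<close> turns
  the first vertex of the branch, drawn outside the tree, into a step drawn from all of
  \<open>V\<close>.\<close>

lemma trees_eq_wait_law: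
  assumes "fst T \<noteq> {}" and "fst T \<subset> V"
  shows "trees (Suc j) T = pmf_of_set (fst T) \<bind> wait_law j T"
proof -
  let ?A = "fst T"
  define Z where "Z v = pmf_of_set ?A \<bind> (\<lambda>u. run_law j (attach T u [v]) v)" for v
  have "fst T \<noteq> V" using assms by auto
  then have "trees (Suc j) T = pmf_of_set ?A \<bind> (\<lambda>u. pmf_of_set (V - ?A) \<bind> (\<lambda>v.
      run_law j (attach T u [v]) v))"
    unfolding run_law_def
    by (simp add: grow_def branch_def bind_assoc_pmf map_bind_pmf bind_map_pmf attach_Cons[symmetric])
  also have "\<dots> = pmf_of_set (V - ?A) \<bind> Z"
    unfolding Z_def by (rule bind_commute_pmf)
  finally have 1: "trees (Suc j) T = pmf_of_set (V - ?A) \<bind> Z" .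
  have "trees (Suc j) T = unif \<bind> (\<lambda>x. if x \<in> ?A then trees (Suc j) T else Z x)"
    unfolding 1 using bind_pmf_of_set_retry[OF finite_V assms(2), of Z] by simp
  also have "\<dots> = unif \<bind> (\<lambda>x. pmf_of_set ?A \<bind> (\<lambda>u.
      if x \<in> ?A then trees (Suc j) T else run_law j (attach T u [x]) x))"
    by (intro bind_pmf_cong) (auto simp: Z_def)
  also have "\<dots> = pmf_of_set ?A \<bind> wait_law j T"
    unfolding wait_law_def by (rule bind_commute_pmf)
  finally show ?thesis .
qed

lemma exploration_law_growing:
  "exploration_law (T, u, True, Suc j) = run_law j T u"
  by (simp add: run_law_full)

lemma exploration_law_step:
  assumes "fst T \<noteq> {}" and "fst T \<subseteq> V"
  shows "exploration_law (T, u, g, j) = unif \<bind> (\<lambda>x. exploration_law (explore (T, u, g, j) x))"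
proof (cases "j = 0 \<or> fst T = V")
  case True
  then show ?thesis by simp
next
  case False
  then obtain j' where j: "j = Suc j'" and T: "fst T \<subset> V"
    using assms by (cases j) auto
  \<comment> \<open>The integrands may differ pointwise, as the right one remembers the vertex
    \<open>x\<close> of the tree; they agree after averaging over \<open>x\<close>, which is uniform
    in the tree given that it lies there.\<close>
  have wait: "unif \<bind> (\<lambda>x. if x \<in> fst T then trees k T else f x) =
      unif \<bind> (\<lambda>x. if x \<in> fst T then exploration_law (T, x, False, k) else f x)" for k f
  proof (cases k)
    case 0
    then show ?thesis by (simp cong: if_cong)
  next
    case (Suc k')
    have "exploration_law (T, x, False, k) = wait_law k' T x" for x
      using Suc T by auto
    then show ?thesis
      using bind_pmf_of_set_resample[OF finite_V assms(2,1), of "wait_law k' T" f]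
      by (simp only: trees_eq_wait_law[OF assms(1) T] Suc)
  qed
  show ?thesis
  proof (cases g)
    case True
    have "exploration_law (T, u, g, j) = run_law j' T u"
      using True j by (simp only: exploration_law_growing)
    also have "\<dots> = unif \<bind> (\<lambda>x. exploration_law (explore (T, u, g, j) x))"
      unfolding run_law_step[of j' T u] wait[of j']
      using False True j by (intro bind_pmf_cong) (auto simp: run_law_full)
    finally show ?thesis .
  next
    case g: False
    have "exploration_law (T, u, g, j) = wait_law j' T u"
      using g j False by simp
    also have "\<dots> = unif \<bind> (\<lambda>x. exploration_law (explore (T, u, g, j) x))"
      unfolding wait_law_def wait[of "Suc j'"]
      using False g j by (intro bind_pmf_cong) (auto simp: run_law_full)
    finally show ?thesis .
  qed
qed

lemma exploration_law_start:
  assumes "r \<in> V"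
  shows "exploration_law (({r}, {}), r, False, i) = trees i ({r}, {})"
proof (cases "i = 0 \<or> {r} = V")
  case True
  then show ?thesis using trees_full[of "({r}, {})" i] by auto
next
  case False
  then obtain j where "i = Suc j" by (cases i) auto
  moreover have "{r} \<subset> V" using False assms by auto
  ultimately show ?thesis
    using trees_eq_wait_law[of "({r}, {})" j] False by (simp add: pmf_of_set_singleton bind_return_pmf)
qed

lemma explore_vertices:
  assumes "set l \<subseteq> V" "fst (fst s) \<noteq> {}" "fst (fst s) \<subseteq> V"
  shows "fst (fst (foldl explore s l)) \<noteq> {} \<and> fst (fst (foldl explore s l)) \<subseteq> V"
  using assms
proof (induction l rule: rev_induct)
  case (snoc x l)
  obtain T u g j where "foldl explore s l = (T, u, g, j)" by (metis surj_pair)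
  then show ?case using snoc by auto
qed simp

end

section \<open>Stopping times of a fixed Aldous-Broder trajectory\<close>

lemma enat_less_Inf_iff: "enat t < Inf {enat s | s. P s} \<longleftrightarrow> (\<forall>s\<le>t. \<not> P s)"
proof -
  have "Inf {enat s | s. P s} \<le> enat t \<longleftrightarrow> Inf {enat s | s. P s} < enat (Suc t)"
    by (cases "Inf {enat s | s. P s}") auto
  also have "\<dots> \<longleftrightarrow> (\<exists>s\<le>t. P s)"
    by (auto simp: Inf_less_iff less_Suc_eq_le)
  finally show ?thesis by (auto simp: not_le[symmetric])
qed

lemma enat_eq_SucI: "enat t < a \<Longrightarrow> \<not> enat (Suc t) < a \<Longrightarrow> a = enat (Suc t)"
  by (cases a) auto

lemma visited_enat: "visited x (enat t) = x ` {..t}"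
  by (auto simp: visited_def)

lemma visited_Suc: "visited x (enat (Suc t)) = insert (x (Suc t)) (visited x (enat t))"
  by (simp add: visited_enat atMost_Suc)

locale trajectory = finite_vertex_set V for V :: "'v::countable set" +
  fixes x :: "nat \<Rightarrow> 'v"
  assumes x_in_V: "x t \<in> V"
begin

lemma less_cover_time_iff: "enat t < cover_time V x \<longleftrightarrow> visited x (enat t) \<noteq> V"
proof -
  have "visited x (enat s) = V \<Longrightarrow> s \<le> t \<Longrightarrow> visited x (enat t) = V" for s
    using x_in_V by (force simp: visited_enat)
  then show ?thesis unfolding cover_time_def enat_less_Inf_iff by auto
qed

text \<open>Strict lower bounds turn the stopping times into conditions on the trajectory up to
  \<open>t\<close>, infinite values included. The truncated \<open>t' - 1\<close> is harmless, since
  \<open>s < enat t'\<close> excludes \<open>t' = 0\<close>.\<close>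

lemma less_next_out_iff: "enat t < next_out V x s \<longleftrightarrow>
    (\<forall>t'\<le>t. s < enat t' \<longrightarrow> x t' \<in> visited x (enat (t' - 1))) \<and> visited x (enat t) \<noteq> V"
  unfolding next_out_def min_less_iff_conj enat_less_Inf_iff less_cover_time_iff by auto

lemma less_next_in_iff: "enat t < next_in V x s \<longleftrightarrow>
    (\<forall>t'\<le>t. s < enat t' \<longrightarrow> x t' \<notin> visited x (enat (t' - 1))) \<and> visited x (enat t) \<noteq> V"
  unfolding next_in_def min_less_iff_conj enat_less_Inf_iff less_cover_time_iff by auto

lemma next_out_cover_time: "next_out V x (cover_time V x) = cover_time V x"
  unfolding next_out_def by (rule min.absorb2, rule Inf_greatest) auto

lemma next_in_cover_time: "next_in V x (cover_time V x) = cover_time V x"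
  unfolding next_in_def by (rule min.absorb2, rule Inf_greatest) auto

lemma sigma_in_cover_time:
  assumes "sigma_in V x k = cover_time V x" "k \<le> i"
  shows "sigma_in V x i = cover_time V x"
  using assms(2,1)
  by (induction rule: dec_induct) (simp_all add: next_out_cover_time next_in_cover_time)

lemma fst_AB_tree [simp]: "fst (AB_tree x s) = visited x s"
  by (simp add: AB_tree_def)

lemma AB_tree_0: "AB_tree x 0 = ({x 0}, {})"
  by (auto simp: AB_tree_def visited_def zero_enat_def)

lemma AB_tree_Suc:
  "AB_tree x (enat (Suc t)) = (if x (Suc t) \<in> visited x (enat t) then AB_tree x (enat t)
     else attach (AB_tree x (enat t)) (x t) [x (Suc t)])"
proof -
  define Q where "Q s \<longleftrightarrow> (\<forall>k\<le>s. x (Suc s) \<noteq> x k)" for s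
  have AB: "AB_tree x (enat s) = (visited x (enat s), (\<lambda>s. {x s, x (Suc s)}) ` {s'. s' < s \<and> Q s'})" for s
    by (simp add: AB_tree_def Q_def setcompr_eq_image)
  have "{s. s < Suc t \<and> Q s} = {s. s < t \<and> Q s} \<union> (if Q t then {t} else {})"
    by (auto simp: less_Suc_eq)
  moreover have "x (Suc t) \<in> visited x (enat t) \<longleftrightarrow> \<not> Q t"
    by (auto simp: visited_enat Q_def)
  ultimately show ?thesis
    by (simp add: AB visited_Suc attach_def insert_absorb)
qed

definition state :: "nat \<Rightarrow> nat \<Rightarrow> 'v exploration" where
  "state i t = foldl explore (({x 0}, {}), x 0, False, i) (map x [1..<Suc t])"

lemma state_0: "state i 0 = (({x 0}, {}), x 0, False, i)"
  by (simp add: state_def)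

lemma state_Suc: "state i (Suc t) = explore (state i t) (x (Suc t))"
  by (simp add: state_def)

text \<open>If no return has happened by time \<open>t\<close> and the step to \<open>Suc t\<close>
  covers \<open>V\<close>, the minimum with the cover time takes effect.\<close>

lemma next_in_at_cover_time:
  assumes "enat t < next_in V x s" "visited x (enat (Suc t)) = V"
  shows "next_in V x s = cover_time V x"
proof -
  have "next_in V x s = enat (Suc t)"
    using assms less_next_in_iff[of "Suc t" s] by (intro enat_eq_SucI) auto
  moreover have "cover_time V x = enat (Suc t)"
    using assms less_next_in_iff[of t s] less_cover_time_iff by (intro enat_eq_SucI) auto
  ultimately show ?thesis by simp
qed

text \<open>Link between the exploration and the stopping times: \<open>k\<close> branches are
  complete, and \<open>g\<close> tells whether \<open>t\<close> lies before or after the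
  \<open>next_out\<close> that follows the \<open>k\<close>-th \<open>sigma_in\<close>. A frozen
  state already holds the tree at the \<open>i\<close>-th \<open>sigma_in\<close>, however large
  \<open>t\<close> becomes.\<close>

fun tracks :: "nat \<Rightarrow> nat \<Rightarrow> 'v exploration \<Rightarrow> bool" where
  "tracks i t (T, u, g, j) =
     (if j = 0 \<or> fst T = V then T = AB_tree x (sigma_in V x i)
      else T = AB_tree x (enat t) \<and> u = x t \<and>
        (\<exists>k. k + j = i \<and> sigma_in V x k \<le> enat t \<and>
          (if g then next_out V x (sigma_in V x k) \<le> enat t \<and> enat t < sigma_in V x (Suc k)
           else enat t < next_out V x (sigma_in V x k))))"

lemma tracks_state: "tracks i t (state i t)"
proof (induction t)
  case 0
  show ?case
  proof (cases "i = 0 \<or> {x 0} = V")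
    case True
    have "sigma_in V x i = 0"
    proof (cases "{x 0} = V")
      case True
      then have "\<not> enat 0 < cover_time V x"
        unfolding less_cover_time_iff by (simp add: visited_enat)
      then have "cover_time V x = 0" by (simp add: zero_enat_def[symmetric])
      then show ?thesis using sigma_in_cover_time[of 0 i] by simp
    qed (use True in simp)
    then show ?thesis using True by (simp add: state_0 AB_tree_0)
  next
    case False
    have "enat 0 < next_out V x 0"
      using False by (simp add: less_next_out_iff visited_enat zero_enat_def)
    then show ?thesis
      using False AB_tree_0 by (auto simp: state_0 zero_enat_def)
  qed
next
  case (Suc t)
  obtain T u g j where s: "state i t = (T, u, g, j)" by (metis surj_pair)
  show ?case
  proof (cases "j = 0 \<or> fst T = V")
    case True
    then show ?thesis using Suc s by (simp add: state_Suc)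
  next
    case False
    then obtain k where T: "T = AB_tree x (enat t)" and u: "u = x t" and k: "k + j = i"
      and sig: "sigma_in V x k \<le> enat t"
      and g: "if g then next_out V x (sigma_in V x k) \<le> enat t \<and> enat t < sigma_in V x (Suc k)
           else enat t < next_out V x (sigma_in V x k)"
      using Suc s by auto
    have nV: "visited x (enat t) \<noteq> V" using False T by simp
    have sig': "sigma_in V x k < enat (Suc t)" using sig by (metis enat_ord_simps(2) lessI order_le_less_trans)
    let ?o = "next_out V x (sigma_in V x k)"
    consider "x (Suc t) \<in> visited x (enat t)" "\<not> g" | "x (Suc t) \<in> visited x (enat t)" "g"
      | "x (Suc t) \<notin> visited x (enat t)" by blast
    then show ?thesis
    proof cases
      case 1
      have "enat (Suc t) < ?o"
        using 1 g nV by (auto simp: less_next_out_iff visited_Suc insert_absorb le_Suc_eq)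
      then show ?thesis
        using 1 s T False k sig' by (auto simp: state_Suc AB_tree_Suc)
    next
      case 2
      have "?o < enat (Suc t)" using g 2 by (metis enat_ord_simps(2) lessI order_le_less_trans)
      then have "sigma_in V x (Suc k) = enat (Suc t)"
        using g 2 by (intro enat_eq_SucI) (auto simp: less_next_in_iff)
      \<comment> \<open>The step that ends a run also begins the next wait, because
        \<open>next_out\<close> looks at strictly later times.\<close>
      moreover from this have "enat (Suc t) < next_out V x (sigma_in V x (Suc k))"
        using nV 2 by (auto simp: less_next_out_iff visited_Suc insert_absorb)
      moreover obtain m where "j = Suc m" using False by (cases j) auto
      moreover from this have "state i (Suc t) = (AB_tree x (enat (Suc t)), x (Suc t), False, m)"
        using 2 s T False by (simp add: state_Suc AB_tree_Suc)
      moreover have "visited x (enat (Suc t)) \<noteq> V"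
        using 2 nV by (simp add: visited_Suc insert_absorb)
      ultimately show ?thesis
        using k by (cases "m = 0") (auto simp del: sigma_in.simps)
    next
      case 3
      have T': "attach T u [x (Suc t)] = AB_tree x (enat (Suc t))"
        using 3 T u by (simp add: AB_tree_Suc)
      have st: "state i (Suc t) = (AB_tree x (enat (Suc t)), x (Suc t), True, j)"
        using 3 False s T T' by (simp add: state_Suc)
      have o: "?o \<le> enat (Suc t)"
      proof (cases g)
        case True
        then show ?thesis using g by (metis enat_ord_simps(1) le_SucI le_refl order_trans)
      next
        case False
        then have "?o = enat (Suc t)"
          using g 3 sig' by (intro enat_eq_SucI) (auto simp: less_next_out_iff)
        then show ?thesis by simp
      qed
      \<comment> \<open>While waiting, \<open>t\<close> is still before \<open>?o\<close>, so the
        condition on returns after \<open>?o\<close> is vacuous up to time \<open>t\<close>.\<close>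
      have *: "enat t < next_in V x ?o"
      proof (cases g)
        case False
        then show ?thesis
          using g nV by (auto simp: less_next_in_iff less_le_trans dest: less_trans order.strict_trans1)
      qed (use g in simp)
      show ?thesis
      proof (cases "visited x (enat (Suc t)) = V")
        case True
        then have c: "cover_time V x = enat (Suc t)"
          using nV by (intro enat_eq_SucI) (auto simp: less_cover_time_iff)
        have "sigma_in V x (Suc k) = cover_time V x"
          using next_in_at_cover_time[OF * True] by simp
        \<comment> \<open>Covering in the middle of a run makes all the remaining
          \<open>sigma_in\<close> equal to the cover time; \<open>Suc k \<le> i\<close> because
          \<open>j > 0\<close>.\<close>
        then have "sigma_in V x i = enat (Suc t)"
          using sigma_in_cover_time[of "Suc k" i] False k c by auto
        then show ?thesis using st True by simp
      next
        case nV': False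
        have "enat (Suc t) < next_in V x ?o"
          using * 3 nV' by (auto simp: less_next_in_iff le_Suc_eq)
        then show ?thesis
          using st nV' False o k sig' by auto
      qed
    qed
  qed
qed

lemma exploration_law_covered:
  assumes "visited x (enat t) = V"
  shows "exploration_law (state i t) = return_pmf (AB_tree x (sigma_in V x i))"
  using tracks_state[of i t] assms by (cases "state i t") (auto split: if_splits)

end

section \<open>Random walks\<close>

lemma random_walkD:
  assumes "random_walk M V \<mu> X"
  shows "prob_space M" and "X t \<in> measurable M (count_space V)"
  using assms unfolding random_walk_def
  by (auto simp: prob_space.indep_vars_def)

lemma map_upt_eq_iff: "map f [0..<n] = l \<longleftrightarrow> length l = n \<and> (\<forall>s<n. f s = l ! s)"
  by (auto simp: list_eq_iff_nth_eq)

lemma vimage_walk_prefix: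
  "(\<lambda>\<omega>. map (\<lambda>s. X s \<omega>) [0..<Suc t]) -` {l} \<inter> space M =
    (if length l = Suc t then {\<omega> \<in> space M. \<forall>s\<le>t. X s \<omega> = l ! s} else {})"
  unfolding vimage_def by (auto simp: map_upt_eq_iff less_Suc_eq_le simp del: upt_Suc)

lemma measurable_walk_prefix:
  fixes X :: "nat \<Rightarrow> 'a \<Rightarrow> 'v::countable"
  assumes [measurable]: "\<And>s. X s \<in> measurable M (count_space UNIV)"
  shows "(\<lambda>\<omega>. map (\<lambda>s. X s \<omega>) [0..<Suc t]) \<in> measurable M (count_space UNIV)"
  unfolding measurable_count_space_eq2_countable vimage_walk_prefix by auto

context finite_vertex_set
begin

lemma random_walk_measurable:
  assumes "random_walk M V \<mu> X"
  shows "X t \<in> measurable M (count_space UNIV)"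
  using random_walkD(2)[OF assms] by (rule measurable_compose) simp

lemma random_walk_in:
  assumes "random_walk M V \<mu> X" "\<omega> \<in> space M"
  shows "X t \<omega> \<in> V"
  using measurable_space[OF random_walkD(2)[OF assms(1)] assms(2)] by simp

lemma measure_walk_prefix:
  assumes rw: "random_walk M V \<mu> X"
  shows "measure M {\<omega> \<in> space M. \<forall>s\<le>t. X s \<omega> = w s} =
    pmf \<mu> (w 0) * (\<Prod>s\<in>{1..t}. pmf unif (w s))"
proof -
  interpret prob_space M using random_walkD(1)[OF rw] .
  have X[measurable]: "X s \<in> measurable M (count_space UNIV)" for s
    by (rule random_walk_measurable[OF rw])
  have ind: "indep_vars (\<lambda>_. count_space V) X UNIV"
    using rw by (simp add: random_walk_def)
  have m: "measure M (X s -` {v} \<inter> space M) = pmf (if s = 0 then \<mu> else unif) v" for s v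
  proof -
    have "measure M (X s -` {v} \<inter> space M) = measure (distr M (count_space UNIV) (X s)) {v}"
      by (rule measure_distr[symmetric]) auto
    also have "distr M (count_space UNIV) (X s) = measure_pmf (if s = 0 then \<mu> else unif)"
      using rw by (cases s) (auto simp: random_walk_def)
    finally show ?thesis by (simp add: pmf.rep_eq)
  qed
  note sp = random_walk_in[OF rw]
  \<comment> \<open>Independence is formulated for \<open>count_space V\<close>, so singletons are
    cut down to \<open>V\<close> to become events there.\<close>
  have e: "X s -` ({w s} \<inter> V) \<inter> space M = X s -` {w s} \<inter> space M" for s
    using sp by auto
  have "{\<omega> \<in> space M. \<forall>s\<le>t. X s \<omega> = w s} = (\<Inter>s\<in>{..t}. X s -` ({w s} \<inter> V) \<inter> space M)"
    using sp by auto
  also have "measure M \<dots> = (\<Prod>s\<in>{..t}. measure M (X s -` ({w s} \<inter> V) \<inter> space M))"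
    by (rule indep_varsD[OF ind]) auto
  also have "\<dots> = (\<Prod>s\<in>{..t}. pmf (if s = 0 then \<mu> else unif) (w s))"
    unfolding e m ..
  also have "{..t} = insert 0 {1..t}" by auto
  also have "(\<Prod>s\<in>insert 0 {1..t}. pmf (if s = 0 then \<mu> else unif) (w s)) =
      pmf \<mu> (w 0) * (\<Prod>s\<in>{1..t}. pmf unif (w s))"
    by (subst prod.insert) (auto intro!: prod.cong)
  finally show ?thesis .
qed

primrec walk_pmf :: "'v pmf \<Rightarrow> nat \<Rightarrow> 'v list pmf" where
  "walk_pmf \<mu> 0 = map_pmf (\<lambda>v. [v]) \<mu>"
| "walk_pmf \<mu> (Suc t) = walk_pmf \<mu> t \<bind> (\<lambda>l. map_pmf (\<lambda>x. l @ [x]) unif)"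

lemma walk_pmf_length: "l \<in> set_pmf (walk_pmf \<mu> t) \<Longrightarrow> length l = Suc t"
  by (induction t arbitrary: l) auto

lemma pmf_walk_pmf:
  "length l = Suc t \<Longrightarrow> pmf (walk_pmf \<mu> t) l = pmf \<mu> (l ! 0) * (\<Prod>s\<in>{1..t}. pmf unif (l ! s))"
proof (induction t arbitrary: l)
  case 0
  then obtain v where "l = [v]" by (auto simp: length_Suc_conv)
  then show ?case using pmf_map_inj'[of "\<lambda>v. [v]" \<mu> v] by (simp add: inj_def)
next
  case (Suc t)
  then obtain k x where l: "l = k @ [x]" and k: "length k = Suc t"
    by (cases l rule: rev_cases) auto
  have "pmf (map_pmf (\<lambda>y. k' @ [y]) unif) l = indicator {k} k' * pmf unif x" for k'
  proof (cases "k' = k")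
    case True
    then show ?thesis using pmf_map_inj'[of "\<lambda>y. k @ [y]" unif x] by (simp add: l inj_def)
  qed (auto simp: l intro!: pmf_map_outside)
  then have "pmf (walk_pmf \<mu> (Suc t)) l = (\<integral>k'. indicator {k} k' * pmf unif x \<partial>walk_pmf \<mu> t)"
    by (simp add: pmf_bind)
  also have "\<dots> = pmf (walk_pmf \<mu> t) k * pmf unif x"
    by (simp add: pmf.rep_eq)
  finally have "pmf (walk_pmf \<mu> (Suc t)) l = pmf (walk_pmf \<mu> t) k * pmf unif x" .
  moreover have "{1..Suc t} = insert (Suc t) {1..t}" by auto
  ultimately show ?case
    using Suc.IH[OF k] k by (simp add: l nth_append)
qed

lemma distr_walk_prefix:
  assumes rw: "random_walk M V \<mu> X"
  shows "distr M (count_space UNIV) (\<lambda>\<omega>. map (\<lambda>s. X s \<omega>) [0..<Suc t]) = measure_pmf (walk_pmf \<mu> t)"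
proof (rule measure_eqI_countable[of _ UNIV])
  interpret prob_space M using random_walkD(1)[OF rw] .
  have X[measurable]: "X s \<in> measurable M (count_space UNIV)" for s
    by (rule random_walk_measurable[OF rw])
  fix l :: "'v list"
  let ?f = "\<lambda>\<omega>. map (\<lambda>s. X s \<omega>) [0..<Suc t]"
  have meas: "?f \<in> measurable M (count_space UNIV)"
    by (rule measurable_walk_prefix) fact
  have em: "emeasure (distr M (count_space UNIV) ?f) {l} = emeasure M (?f -` {l} \<inter> space M)"
    by (rule emeasure_distr[OF meas]) simp
  show "emeasure (distr M (count_space UNIV) ?f) {l} = emeasure (measure_pmf (walk_pmf \<mu> t)) {l}"
  proof (cases "length l = Suc t")
    case True
    then show ?thesis
      unfolding em vimage_walk_prefix
      by (simp add: emeasure_eq_measure measure_walk_prefix[OF rw] pmf_walk_pmf emeasure_pmf_single)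
  next
    case False
    then have "l \<notin> set_pmf (walk_pmf \<mu> t)" using walk_pmf_length by blast
    then show ?thesis
      using False unfolding em vimage_walk_prefix
      by (simp add: emeasure_pmf_single set_pmf_iff)
  qed
qed auto

lemma AE_walk_visits:
  assumes rw: "random_walk M V \<mu> X" and v: "v \<in> V"
  shows "AE \<omega> in M. \<exists>t. X t \<omega> = v"
proof -
  interpret prob_space M using random_walkD(1)[OF rw] .
  have X[measurable]: "X s \<in> measurable M (count_space UNIV)" for s
    by (rule random_walk_measurable[OF rw])
  have ind: "indep_vars (\<lambda>_. count_space V) X UNIV"
    using rw by (simp add: random_walk_def)
  define q where "q = measure unif (- {v})"
  have "q = 1 - pmf unif v"
    unfolding q_def pmf.rep_eq using measure_pmf.prob_compl[of "{v}" unif] by (simp add: Compl_eq_Diff_UNIV)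
  moreover have "pmf unif v > 0" using v by (simp add: pmf_positive)
  ultimately have q: "q < 1" "0 \<le> q" using pmf_le_1[of unif v] by auto
  let ?N = "{\<omega> \<in> space M. \<forall>t. X t \<omega> \<noteq> v}"
  have "measure M ?N \<le> q ^ t" for t
  proof (cases "t = 0")
    case False
    \<comment> \<open>Only the times from 1 on have a uniform vertex; time 0 has law
      \<open>\<mu>\<close> and is left out of the bound.\<close>
    have "measure M ?N \<le> measure M (\<Inter>s\<in>{1..t}. X s -` (V - {v}) \<inter> space M)"
      using False by (intro finite_measure_mono) (auto intro: random_walk_in[OF rw])
    also have "\<dots> = (\<Prod>s\<in>{1..t}. measure M (X s -` (V - {v}) \<inter> space M))"
      using False by (intro indep_varsD[OF ind]) auto
    also have "\<dots> = (\<Prod>s\<in>{1..t}. q)"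
    proof (rule prod.cong[OF refl])
      fix s assume "s \<in> {1..t}"
      then obtain s' where s: "s = Suc s'" by (cases s) auto
      have "measure M (X s -` (V - {v}) \<inter> space M) = measure M (X s -` (- {v}) \<inter> space M)"
        by (rule arg_cong[where f="measure M"]) (auto intro: random_walk_in[OF rw])
      also have "\<dots> = measure (distr M (count_space UNIV) (X s)) (- {v})"
        by (rule measure_distr[symmetric]) auto
      also have "\<dots> = q"
        using rw by (simp add: s random_walk_def q_def)
      finally show "measure M (X s -` (V - {v}) \<inter> space M) = q" .
    qed
    finally show ?thesis by simp
  qed simp
  moreover have "(\<lambda>t. q ^ t) \<longlonglongrightarrow> 0" using q by (intro LIMSEQ_power_zero) auto
  ultimately have "measure M ?N \<le> 0" by (intro LIMSEQ_le_const) auto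
  then have "measure M ?N = 0" using measure_nonneg[of M ?N] by linarith
  then show ?thesis
    by (subst AE_iff_null) (auto simp: null_sets_def emeasure_eq_measure)
qed

text \<open>\<open>H\<close> is a martingale along the walk, so its value at the starting vertex is the law of the
  value at which it gets constant.\<close>

lemma distr_walk_functional:
  assumes rw: "random_walk M V \<mu> X"
    and H: "\<And>l. l \<noteq> [] \<Longrightarrow> set l \<subseteq> V \<Longrightarrow> hd l \<in> set_pmf \<mu> \<Longrightarrow> H l = unif \<bind> (\<lambda>x. H (l @ [x]))"
    and \<mu>: "set_pmf \<mu> \<subseteq> V"
    and F: "F \<in> measurable M (count_space UNIV)"
    and lim: "AE \<omega> in M. \<exists>t0. \<forall>t\<ge>t0. H (map (\<lambda>s. X s \<omega>) [0..<Suc t]) = return_pmf (F \<omega>)"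
  shows "distr M (count_space UNIV) F = measure_pmf (\<mu> \<bind> (\<lambda>v. H [v]))"
proof (rule measure_eqI)
  interpret prob_space M using random_walkD(1)[OF rw] .
  have X[measurable]: "X s \<in> measurable M (count_space UNIV)" for s
    by (rule random_walk_measurable[OF rw])
  fix B assume "B \<in> sets (distr M (count_space UNIV) F)"
  let ?p = "\<lambda>t \<omega>. map (\<lambda>s. X s \<omega>) [0..<Suc t]"
  have meas[measurable]: "?p t \<in> measurable M (count_space UNIV)" for t
    by (rule measurable_walk_prefix) fact
  have supp: "l \<noteq> [] \<and> set l \<subseteq> V \<and> hd l \<in> set_pmf \<mu>" if "l \<in> set_pmf (walk_pmf \<mu> t)" for l t
    using that
  proof (induction t arbitrary: l)
    case 0
    then show ?case using \<mu> by auto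
  next
    case (Suc t)
    then obtain k x where "k \<in> set_pmf (walk_pmf \<mu> t)" "l = k @ [x]" "x \<in> V" by auto
    with Suc.IH[of k] show ?case by auto
  qed
  have inv: "walk_pmf \<mu> t \<bind> H = \<mu> \<bind> (\<lambda>v. H [v])" for t
  proof (induction t)
    case 0
    then show ?case by (simp add: bind_map_pmf)
  next
    case (Suc t)
    have "walk_pmf \<mu> (Suc t) \<bind> H = walk_pmf \<mu> t \<bind> (\<lambda>l. unif \<bind> (\<lambda>x. H (l @ [x])))"
      by (simp add: bind_assoc_pmf bind_map_pmf)
    also have "\<dots> = walk_pmf \<mu> t \<bind> H"
      using H supp by (intro bind_pmf_cong) auto
    finally show ?case using Suc by simp
  qed
  have const: "(\<integral>\<^sup>+\<omega>. emeasure (measure_pmf (H (?p t \<omega>))) B \<partial>M) =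
      emeasure (measure_pmf (\<mu> \<bind> (\<lambda>v. H [v]))) B" for t
  proof -
    have "(\<integral>\<^sup>+\<omega>. emeasure (measure_pmf (H (?p t \<omega>))) B \<partial>M) =
      (\<integral>\<^sup>+l. emeasure (measure_pmf (H l)) B \<partial>distr M (count_space UNIV) (?p t))"
      by (rule nn_integral_distr[OF meas, symmetric]) simp
    also have "\<dots> = emeasure (measure_pmf (walk_pmf \<mu> t \<bind> H)) B"
      by (simp only: distr_walk_prefix[OF rw] emeasure_bind_pmf)
    finally show ?thesis unfolding inv .
  qed
  \<comment> \<open>The integrals do not depend on \<open>t\<close>, by \<open>const\<close>. Along
    almost every path the integrand is eventually the indicator of
    \<open>F \<omega> \<in> B\<close>, and it is bounded by 1, so the constant equals the
    limit.\<close>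
  have "(\<lambda>t. \<integral>\<^sup>+\<omega>. emeasure (measure_pmf (H (?p t \<omega>))) B \<partial>M) \<longlonglongrightarrow>
      (\<integral>\<^sup>+\<omega>. indicator B (F \<omega>) \<partial>M)"
  proof (rule nn_integral_dominated_convergence[where w="\<lambda>_. 1"])
    show "(\<lambda>\<omega>. emeasure (measure_pmf (H (?p t \<omega>))) B) \<in> borel_measurable M" for t
      by (rule measurable_compose[OF meas]) simp
    show "(\<lambda>\<omega>. indicator B (F \<omega>)) \<in> borel_measurable M"
      by (rule measurable_compose[OF F]) simp
    show "AE \<omega> in M. (\<lambda>t. emeasure (measure_pmf (H (?p t \<omega>))) B) \<longlonglongrightarrow> indicator B (F \<omega>)"
      using lim
    proof eventually_elim
      case (elim \<omega>)
      then obtain t0 where "\<forall>t\<ge>t0. H (?p t \<omega>) = return_pmf (F \<omega>)" by blast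
      then have "\<forall>\<^sub>F t in sequentially. emeasure (measure_pmf (H (?p t \<omega>))) B = indicator B (F \<omega>)"
        unfolding eventually_sequentially by (intro exI[of _ t0]) (auto simp del: upt_Suc)
      then show ?case by (rule tendsto_eventually)
    qed
  qed (auto simp: measure_pmf.emeasure_le_1 emeasure_space_1)
  then have "(\<integral>\<^sup>+\<omega>. indicator B (F \<omega>) \<partial>M) = emeasure (measure_pmf (\<mu> \<bind> (\<lambda>v. H [v]))) B"
    unfolding const by (simp add: LIMSEQ_const_iff)
  moreover have "(\<integral>\<^sup>+\<omega>. indicator B (F \<omega>) \<partial>M) = emeasure (distr M (count_space UNIV) F) B"
    using F by (subst emeasure_distr) (auto simp: nn_integral_indicator[symmetric]
      indicator_vimage[symmetric] simp del: nn_integral_indicator intro!: nn_integral_cong split: split_indicator)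
  ultimately show "emeasure (distr M (count_space UNIV) F) B = emeasure (measure_pmf (\<mu> \<bind> (\<lambda>v. H [v]))) B"
    by simp
qed simp

end

section \<open>Measurability\<close>

lemma measurable_Inf_enat:
  assumes [measurable]: "\<And>t. Measurable.pred M (P t)"
  shows "(\<lambda>\<omega>. Inf {enat t | t. P t \<omega>}) \<in> measurable M (count_space UNIV)"
proof -
  have "Inf {enat t | t. P t \<omega>} = (if \<exists>t. P t \<omega> then enat (LEAST t. P t \<omega>) else \<infinity>)" for \<omega>
  proof (cases "\<exists>t. P t \<omega>")
    case True
    have "Inf {enat t | t. P t \<omega>} = enat (LEAST t. P t \<omega>)"
    proof (rule Inf_eqI)
      fix a assume "a \<in> {enat t | t. P t \<omega>}"
      then obtain t where "a = enat t" "P t \<omega>" by blast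
      then show "enat (LEAST t. P t \<omega>) \<le> a" using Least_le[of "\<lambda>t. P t \<omega>" t] by simp
    next
      fix a assume "\<And>b. b \<in> {enat t | t. P t \<omega>} \<Longrightarrow> a \<le> b"
      then show "a \<le> enat (LEAST t. P t \<omega>)" using LeastI_ex[OF True] by blast
    qed
    then show ?thesis using True by simp
  next
    case False
    then have "{enat t | t. P t \<omega>} = {}" by blast
    then show ?thesis using False by (simp add: top_enat_def)
  qed
  moreover have "(\<lambda>\<omega>. if \<exists>t. P t \<omega> then enat (LEAST t. P t \<omega>) else \<infinity>) \<in> measurable M (count_space UNIV)"
    by measurable
  ultimately show ?thesis by (simp only:)
qed

lemma measurable_compose_countable2:
  fixes f :: "'a \<Rightarrow> 'b::countable" and g :: "'a \<Rightarrow> 'c::countable"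
  assumes f: "f \<in> measurable M (count_space UNIV)" and g: "g \<in> measurable M (count_space UNIV)"
  shows "(\<lambda>\<omega>. h (f \<omega>) (g \<omega>)) \<in> measurable M (count_space UNIV)"
  using f by (rule measurable_compose_countable[rotated]) (rule measurable_compose[OF g], simp)

lemma measurable_visited_eq:
  fixes X :: "nat \<Rightarrow> 'a \<Rightarrow> 'v::countable"
  assumes [measurable]: "\<And>t. X t \<in> measurable M (count_space UNIV)" and "finite V"
  shows "Measurable.pred M (\<lambda>\<omega>. visited (\<lambda>t. X t \<omega>) (enat t) = V)"
proof -
  have eq: "visited (\<lambda>t. X t \<omega>) (enat t) = V \<longleftrightarrow> (\<forall>k\<in>{..t}. X k \<omega> \<in> V) \<and> (\<forall>v\<in>V. \<exists>k\<in>{..t}. X k \<omega> = v)" for \<omega>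
    by (auto simp: visited_enat)
  show ?thesis unfolding eq using assms(2) by measurable
qed

lemma measurable_in_visited:
  fixes X :: "nat \<Rightarrow> 'a \<Rightarrow> 'v::countable"
  assumes [measurable]: "\<And>t. X t \<in> measurable M (count_space UNIV)"
  shows "Measurable.pred M (\<lambda>\<omega>. X t \<omega> \<in> visited (\<lambda>t. X t \<omega>) (enat s))"
proof -
  have eq: "X t \<omega> \<in> visited (\<lambda>t. X t \<omega>) (enat s) \<longleftrightarrow> (\<exists>k\<in>{..s}. X t \<omega> = X k \<omega>)" for \<omega>
    by (auto simp: visited_enat)
  have [measurable]: "Measurable.pred M (\<lambda>\<omega>. X t \<omega> = X k \<omega>)" for k
    by (rule measurable_compose_countable2[where h="(=)"]) measurable
  show ?thesis unfolding eq by measurable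
qed

lemma measurable_sigma_in:
  fixes X :: "nat \<Rightarrow> 'a \<Rightarrow> 'v::countable"
  assumes X: "\<And>t. X t \<in> measurable M (count_space UNIV)" and V: "finite V"
  shows "(\<lambda>\<omega>. sigma_in V (\<lambda>t. X t \<omega>) i) \<in> measurable M (count_space UNIV)"
proof -
  have less: "Measurable.pred M (\<lambda>\<omega>. s \<omega> < enat t)" if "s \<in> measurable M (count_space UNIV)" for s t
    by (rule measurable_compose[OF that]) simp
  note [measurable] = measurable_in_visited[OF X] measurable_visited_eq[OF X V]
  have cov: "(\<lambda>\<omega>. cover_time V (\<lambda>t. X t \<omega>)) \<in> measurable M (count_space UNIV)"
    unfolding cover_time_def by (rule measurable_Inf_enat) measurable
  have outward: "(\<lambda>\<omega>. next_out V (\<lambda>t. X t \<omega>) (s \<omega>)) \<in> measurable M (count_space UNIV)"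
    and inward: "(\<lambda>\<omega>. next_in V (\<lambda>t. X t \<omega>) (s \<omega>)) \<in> measurable M (count_space UNIV)"
    if "s \<in> measurable M (count_space UNIV)" for s
  proof -
    note [measurable] = less[OF that]
    show "(\<lambda>\<omega>. next_out V (\<lambda>t. X t \<omega>) (s \<omega>)) \<in> measurable M (count_space UNIV)"
      unfolding next_out_def
      by (rule measurable_compose_countable2[where h=min, OF measurable_Inf_enat cov]) measurable
    show "(\<lambda>\<omega>. next_in V (\<lambda>t. X t \<omega>) (s \<omega>)) \<in> measurable M (count_space UNIV)"
      unfolding next_in_def
      by (rule measurable_compose_countable2[where h=min, OF measurable_Inf_enat cov]) measurable
  qed
  show ?thesis
    by (induction i) (simp_all add: outward inward)
qed

lemma measurable_stopped_walk:
  fixes X :: "nat \<Rightarrow> 'a \<Rightarrow> 'v::countable"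
  assumes [measurable]: "\<And>t. X t \<in> measurable M (count_space UNIV)"
  shows "(\<lambda>\<omega>. hitting_time S (\<lambda>t. X t \<omega>)) \<in> measurable M (count_space UNIV)"
    and "(\<lambda>\<omega>. stopped_walk S (\<lambda>t. X t \<omega>)) \<in> measurable M (count_space UNIV)"
proof -
  show h: "(\<lambda>\<omega>. hitting_time S (\<lambda>t. X t \<omega>)) \<in> measurable M (count_space UNIV)"
    unfolding hitting_time_def by (rule measurable_Inf_enat) measurable
  have "(\<lambda>\<omega>. case h of enat t \<Rightarrow> map (\<lambda>t. X t \<omega>) [0..<Suc t] | \<infinity> \<Rightarrow> []) \<in> measurable M (count_space UNIV)" for h
    using measurable_walk_prefix[of X M] by (cases h) auto
  from measurable_compose_countable[OF this h]
  show "(\<lambda>\<omega>. stopped_walk S (\<lambda>t. X t \<omega>)) \<in> measurable M (count_space UNIV)"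
    unfolding stopped_walk_def .
qed

context finite_vertex_set
begin

text \<open>The target type of sets of vertices and edges may be uncountable, but only the finitely
  many pairs with vertices in \<open>V\<close> and edges contained in \<open>V\<close> are attained,
  each singled out by finitely many membership events.\<close>

lemma measurable_graph:
  assumes sub: "\<And>\<omega>. \<omega> \<in> space M \<Longrightarrow> fst (F \<omega>) \<subseteq> V \<and> snd (F \<omega>) \<subseteq> Pow V"
    and v[measurable]: "\<And>v. Measurable.pred M (\<lambda>\<omega>. v \<in> fst (F \<omega>))"
    and e[measurable]: "\<And>e. Measurable.pred M (\<lambda>\<omega>. e \<in> snd (F \<omega>))"
  shows "F \<in> measurable M (count_space UNIV)"
proof -
  have "F -` {T} \<inter> space M \<in> sets M" if "T \<in> Pow V \<times> Pow (Pow V)" for T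
  proof -
    have "F -` {T} \<inter> space M = {\<omega> \<in> space M. (\<forall>v\<in>V. v \<in> fst (F \<omega>) \<longleftrightarrow> v \<in> fst T) \<and>
        (\<forall>e\<in>Pow V. e \<in> snd (F \<omega>) \<longleftrightarrow> e \<in> snd T)}"
      using sub that by (fastforce simp: prod_eq_iff set_eq_iff)
    also have "\<dots> \<in> sets M"
      using finite_V finite_Pow_iff[THEN iffD2, OF finite_V] by measurable
    finally show ?thesis .
  qed
  moreover have "F \<in> space M \<rightarrow> Pow V \<times> Pow (Pow V)"
    using sub by (auto simp: mem_Times_iff)
  ultimately have "F \<in> measurable M (count_space (Pow V \<times> Pow (Pow V)))"
    using finite_V by (subst measurable_count_space_eq2) auto
  then show ?thesis by (rule measurable_compose) simp
qed

section \<open>The law of the Aldous-Broder tree\<close>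

lemma measurable_AB_tree:
  assumes rw: "random_walk M V \<mu> X"
  shows "(\<lambda>\<omega>. AB_tree (\<lambda>t. X t \<omega>) (sigma_in V (\<lambda>t. X t \<omega>) i)) \<in> measurable M (count_space UNIV)"
proof (rule measurable_graph)
  note [measurable] = random_walk_measurable[OF rw]
  have s: "(\<lambda>\<omega>. sigma_in V (\<lambda>t. X t \<omega>) i) \<in> measurable M (count_space UNIV)"
    by (rule measurable_sigma_in[OF random_walk_measurable[OF rw] finite_V])
  have [measurable]: "Measurable.pred M (\<lambda>\<omega>. enat t < sigma_in V (\<lambda>t. X t \<omega>) i)"
    "Measurable.pred M (\<lambda>\<omega>. enat t \<le> sigma_in V (\<lambda>t. X t \<omega>) i)" for t
    by (rule measurable_compose[OF s], simp)+
  show "fst (AB_tree (\<lambda>t. X t \<omega>) (sigma_in V (\<lambda>t. X t \<omega>) i)) \<subseteq> V \<and>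
      snd (AB_tree (\<lambda>t. X t \<omega>) (sigma_in V (\<lambda>t. X t \<omega>) i)) \<subseteq> Pow V" if "\<omega> \<in> space M" for \<omega>
    using random_walk_in[OF rw that] by (auto simp: AB_tree_def visited_def)
  show "Measurable.pred M (\<lambda>\<omega>. v \<in> fst (AB_tree (\<lambda>t. X t \<omega>) (sigma_in V (\<lambda>t. X t \<omega>) i)))" for v
    unfolding AB_tree_def fst_conv visited_def mem_Collect_eq by measurable
  have [measurable]: "Measurable.pred M (\<lambda>\<omega>. e = {X t \<omega>, X t' \<omega>})"
    "Measurable.pred M (\<lambda>\<omega>. X t \<omega> \<noteq> X t' \<omega>)" for e t t'
    by (rule measurable_compose_countable2[where h="\<lambda>a b. e = {a, b}"]; measurable)
      (rule measurable_compose_countable2[where h="\<lambda>a b. a \<noteq> b"]; measurable)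
  show "Measurable.pred M (\<lambda>\<omega>. e \<in> snd (AB_tree (\<lambda>t. X t \<omega>) (sigma_in V (\<lambda>t. X t \<omega>) i)))" for e
    unfolding AB_tree_def snd_conv mem_Collect_eq by measurable
qed

lemma AE_random_walk_start:
  assumes rw: "random_walk M V \<mu> X"
  shows "AE \<omega> in M. X 0 \<omega> \<in> set_pmf \<mu>"
proof -
  have distr: "distr M (count_space UNIV) (X 0) = measure_pmf \<mu>"
    using rw unfolding random_walk_def by blast
  have "AE v in distr M (count_space UNIV) (X 0). v \<in> set_pmf \<mu>"
    unfolding distr by (rule AE_measure_pmf)
  then show ?thesis
    by (subst (asm) AE_distr_iff) (auto intro: random_walk_measurable[OF rw])
qed

lemma distr_AB_tree:
  assumes rw: "random_walk M V (return_pmf r) X" and r: "r \<in> V"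
  shows "distr M (count_space UNIV) (\<lambda>\<omega>. AB_tree (\<lambda>t. X t \<omega>) (sigma_in V (\<lambda>t. X t \<omega>) i)) =
    measure_pmf (trees i ({r}, {}))"
proof -
  let ?s = "(({r}, {}), r, False, i) :: 'v exploration"
  \<comment> \<open>The head of the prefix is the starting vertex, which the initial state contains
    already; it equals \<open>r\<close> almost surely.\<close>
  define H where "H l = exploration_law (foldl explore ?s (tl l))" for l
  have "distr M (count_space UNIV) (\<lambda>\<omega>. AB_tree (\<lambda>t. X t \<omega>) (sigma_in V (\<lambda>t. X t \<omega>) i)) =
    measure_pmf (return_pmf r \<bind> (\<lambda>v. H [v]))"
  proof (rule distr_walk_functional[OF rw])
    fix l :: "'v list"
    assume l: "l \<noteq> []" "set l \<subseteq> V"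
    obtain T u g j where s: "foldl explore ?s (tl l) = (T, u, g, j)" by (metis surj_pair)
    have "set (tl l) \<subseteq> V" using l by (cases l) auto
    then have "fst T \<noteq> {}" "fst T \<subseteq> V"
      using explore_vertices[of "tl l" ?s] r s by auto
    from exploration_law_step[OF this, of u g j]
    show "H l = unif \<bind> (\<lambda>x. H (l @ [x]))"
      using l(1) by (simp add: H_def s)
  next
    show "AE \<omega> in M. \<exists>t0. \<forall>t\<ge>t0. H (map (\<lambda>s. X s \<omega>) [0..<Suc t]) =
      return_pmf (AB_tree (\<lambda>t. X t \<omega>) (sigma_in V (\<lambda>t. X t \<omega>) i))"
    proof -
      have "AE \<omega> in M. \<forall>v\<in>V. \<exists>t. X t \<omega> = v"
        by (rule AE_finite_allI[OF finite_V AE_walk_visits[OF rw]])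
      with AE_random_walk_start[OF rw] AE_space show ?thesis
      proof eventually_elim
        case (elim \<omega>)
        then interpret trajectory V "\<lambda>t. X t \<omega>"
          by unfold_locales (auto intro: random_walk_in[OF rw])
        obtain f where f: "\<forall>v\<in>V. X (f v) \<omega> = v" using elim(3) by metis
        have "H (map (\<lambda>s. X s \<omega>) [0..<Suc t]) =
          return_pmf (AB_tree (\<lambda>t. X t \<omega>) (sigma_in V (\<lambda>t. X t \<omega>) i))" if "t \<ge> Max (f ` V)" for t
        proof -
          have "f v \<le> t" if "v \<in> V" for v
            using that \<open>t \<ge> Max (f ` V)\<close> finite_V by (meson Max_ge dual_order.trans finite_imageI imageI)
          then have "visited (\<lambda>t. X t \<omega>) (enat t) = V"
            using f x_in_V by (force simp: visited_enat image_iff)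
          from exploration_law_covered[OF this, of i]
          show ?thesis using elim(1)
            by (simp add: H_def state_def upt_conv_Cons del: upt_Suc)
        qed
        then show ?case by blast
      qed
    qed
  qed (use r measurable_AB_tree[OF rw] in auto)
  then show ?thesis
    using exploration_law_start[OF r] by (simp add: H_def bind_return_pmf)
qed

section \<open>The law of Wilson's tree\<close>

lemma distr_branch:
  assumes rw: "random_walk M V (pmf_of_set (V - fst T)) X" and T: "fst T \<noteq> {}" "fst T \<subset> V"
  shows "distr M (count_space UNIV) (\<lambda>\<omega>. add_branch T (stopped_walk (fst T) (\<lambda>t. X t \<omega>))) =
    measure_pmf (grow T)"
proof -
  have fVS: "finite (V - fst T)" "V - fst T \<noteq> {}" using T finite_V by auto
  have "distr M (count_space UNIV) (\<lambda>\<omega>. add_branch T (stopped_walk (fst T) (\<lambda>t. X t \<omega>))) =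
    measure_pmf (pmf_of_set (V - fst T) \<bind> (\<lambda>v. wilson_law T [v]))"
  proof (rule distr_walk_functional[OF rw])
    show "(\<lambda>\<omega>. add_branch T (stopped_walk (fst T) (\<lambda>t. X t \<omega>))) \<in> measurable M (count_space UNIV)"
      by (rule measurable_compose[OF measurable_stopped_walk(2)[OF random_walk_measurable[OF rw]]]) simp
    obtain v where v: "v \<in> fst T" using T by auto
    then have "AE \<omega> in M. \<exists>t. X t \<omega> = v" using T by (intro AE_walk_visits[OF rw]) auto
    then show "AE \<omega> in M. \<exists>t0. \<forall>t\<ge>t0. wilson_law T (map (\<lambda>s. X s \<omega>) [0..<Suc t]) =
      return_pmf (add_branch T (stopped_walk (fst T) (\<lambda>t. X t \<omega>)))"
    proof eventually_elim
      case (elim \<omega>)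
      then obtain t0 where t0: "X t0 \<omega> \<in> fst T" using v by auto
      have "wilson_law T (map (\<lambda>s. X s \<omega>) [0..<Suc t]) =
        return_pmf (add_branch T (stopped_walk (fst T) (\<lambda>t. X t \<omega>)))" if "t0 \<le> t" for t
      proof -
        have "set (map (\<lambda>s. X s \<omega>) [0..<Suc t]) \<inter> fst T \<noteq> {}"
          using t0 that by (auto simp: disjoint_iff less_Suc_eq_le simp del: upt_Suc)
        moreover have "stopped_walk (fst T) (\<lambda>t. X t \<omega>) = stopped_list (fst T) (map (\<lambda>s. X s \<omega>) [0..<Suc t])"
          using t0 that by (intro stopped_walk_eq) auto
        ultimately show ?thesis by (simp add: wilson_law_def del: upt_Suc)
      qed
      then show ?case by blast
    qed
  qed (use T fVS wilson_law_step in auto)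
  then show ?thesis unfolding wilson_law_start[OF T] .
qed

end

text \<open>The points without mass form a countable union of null singletons, so almost every point
  is an atom, as a \<open>pmf\<close> demands.\<close>

lemma (in prob_space) ex_pmf_distr:
  fixes W :: "'a \<Rightarrow> 'w::countable"
  assumes W: "W \<in> measurable M (count_space UNIV)"
  obtains q where "distr M (count_space UNIV) W = measure_pmf q"
proof -
  let ?D = "distr M (count_space UNIV) W"
  have "AE x in ?D. measure ?D {x} \<noteq> 0"
  proof -
    interpret D: prob_space ?D by (rule prob_space_distr[OF W])
    have "{x. measure ?D {x} = 0} \<in> null_sets ?D"
    proof -
      have "(\<Union>x\<in>{x. measure ?D {x} = 0}. {x}) \<in> null_sets ?D"
        by (rule null_sets_UN') (auto simp: null_sets_def D.emeasure_eq_measure)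
      then show ?thesis by simp
    qed
    from AE_not_in[OF this] show ?thesis by simp
  qed
  then have "measure_pmf (Abs_pmf ?D) = ?D"
    using prob_space_distr[OF W] by (intro Abs_pmf_inverse) simp
  then show thesis using that[of "Abs_pmf ?D"] by simp
qed

text \<open>Total probability over the countably many values of \<open>W\<close>. Values of
  probability zero contribute nothing to either side, so \<open>\<kappa>\<close> is constrained on
  atoms only, in the form in which \<open>wilson_process\<close> describes its walks.\<close>

lemma distr_eq_bind_pmf:
  fixes W :: "'a \<Rightarrow> 'w::countable"
  assumes M: "prob_space M"
    and W: "W \<in> measurable M (count_space UNIV)" and q: "distr M (count_space UNIV) W = measure_pmf q"
    and F: "F \<in> measurable M (count_space UNIV)"
    and \<kappa>: "\<And>w. measure M {\<omega> \<in> space M. W \<omega> = w} > 0 \<Longrightarrow>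
      distr (uniform_measure M {\<omega> \<in> space M. W \<omega> = w}) (count_space UNIV) F = measure_pmf (\<kappa> w)"
  shows "distr M (count_space UNIV) F = measure_pmf (q \<bind> \<kappa>)"
proof (rule measure_eqI)
  interpret prob_space M by (rule M)
  note W[measurable] F[measurable]
  fix B assume "B \<in> sets (distr M (count_space UNIV) F)"
  let ?A = "\<lambda>w. {\<omega> \<in> space M. W \<omega> = w}"
  let ?B = "F -` B \<inter> space M"
  have B: "?B \<in> sets M" by (rule measurable_sets[OF F]) simp
  have pq: "emeasure M (?A w) = pmf q w" for w
  proof -
    have "emeasure (distr M (count_space UNIV) W) {w} = emeasure M (W -` {w} \<inter> space M)"
      by (rule emeasure_distr[OF W]) simp
    also have "W -` {w} \<inter> space M = ?A w" by auto
    finally show ?thesis by (simp add: q emeasure_pmf_single)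
  qed
  have "emeasure M ?B = emeasure M (\<Union>w. ?B \<inter> ?A w)"
    by (rule arg_cong[where f="emeasure M"]) auto
  also have "\<dots> = (\<integral>\<^sup>+w. emeasure M (?B \<inter> ?A w) \<partial>count_space UNIV)"
    using B by (intro emeasure_UN_countable) (auto simp: disjoint_family_on_def)
  also have "\<dots> = (\<integral>\<^sup>+w. ennreal (pmf q w) * emeasure (\<kappa> w) B \<partial>count_space UNIV)"
  proof (rule nn_integral_cong)
    fix w
    show "emeasure M (?B \<inter> ?A w) = ennreal (pmf q w) * emeasure (\<kappa> w) B"
    proof (cases "pmf q w = 0")
      case True
      have "emeasure M (?B \<inter> ?A w) \<le> emeasure M (?A w)" by (rule emeasure_mono) auto
      then show ?thesis using True by (simp add: pq)
    next
      case False
      then have "emeasure (\<kappa> w) B = emeasure (distr (uniform_measure M (?A w)) (count_space UNIV) F) B"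
        using \<kappa>[of w] pq[of w] by (simp add: emeasure_eq_measure pmf_pos)
      also have "\<dots> = emeasure (uniform_measure M (?A w)) ?B"
        by (subst emeasure_distr) auto
      also have "\<dots> = emeasure M (?B \<inter> ?A w) / pmf q w"
        using B by (simp add: pq Int_commute)
      finally have "emeasure (\<kappa> w) B = emeasure M (?B \<inter> ?A w) / ennreal (pmf q w)" .
      moreover have "ennreal (pmf q w) * (e / ennreal (pmf q w)) = e" for e
        using False pmf_nonneg[of q w]
        by (simp add: ennreal_times_divide mult.commute[of "ennreal (pmf q w)"] mult_divide_eq_ennreal)
      ultimately show ?thesis by simp
    qed
  qed
  also have "\<dots> = emeasure (measure_pmf (q \<bind> \<kappa>)) B"
    by (simp add: nn_integral_measure_pmf)
  finally show "emeasure (distr M (count_space UNIV) F) B = emeasure (measure_pmf (q \<bind> \<kappa>)) B"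
    by (simp add: emeasure_distr[OF F])
qed simp

section \<open>Wilson's graph along fixed trajectories\<close>

lemma wilson_graph_snoc: "wilson_graph r (ws @ [w]) = add_branch (wilson_graph r ws) w"
  by (simp add: wilson_graph_def)

context
  fixes V :: "'v set" and r :: 'v and y :: "nat \<Rightarrow> nat \<Rightarrow> 'v"
begin

private abbreviation (input) "G j \<equiv> wilson_graph r (wilson_walks V r y j)"
private abbreviation (input) "\<tau> j \<equiv> wilson_time V r y j"

lemma wilson_graph_Suc:
  "G (Suc j) = (if fst (G j) = V then G j else add_branch (G j) (stopped_walk (fst (G j)) (y j)))"
  by (simp add: Let_def wilson_graph_snoc)

lemma wilson_graph_mono:
  assumes "j \<le> k"
  shows "fst (G j) \<subseteq> fst (G k)" and "snd (G j) \<subseteq> snd (G k)"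
proof -
  have step: "fst (G j) \<subseteq> fst (G (Suc j))" "snd (G j) \<subseteq> snd (G (Suc j))" for j
    unfolding wilson_graph_Suc by (simp_all add: add_branch_def)
  from lift_Suc_mono_le[of "\<lambda>j. fst (G j)", OF step(1) assms]
    lift_Suc_mono_le[of "\<lambda>j. snd (G j)", OF step(2) assms]
  show "fst (G j) \<subseteq> fst (G k)" "snd (G j) \<subseteq> snd (G k)" .
qed

lemma wilson_graph_sub:
  assumes "r \<in> V" and "\<And>j t. y j t \<in> V"
  shows "r \<in> fst (G j)" and "fst (G j) \<subseteq> V" and "snd (G j) \<subseteq> Pow V"
proof -
  have "r \<in> fst (G 0)" by (simp add: wilson_graph_def)
  then show "r \<in> fst (G j)" using wilson_graph_mono(1)[of 0 j] by blast
  have sub: "set (loop_erasure (stopped_walk S (y j))) \<subseteq> V" for S j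
  proof -
    have "set (stopped_walk S (y j)) \<subseteq> V"
      unfolding stopped_walk_def
      by (cases "hitting_time S (y j)") (simp_all add: image_subset_iff assms(2))
    then show ?thesis by (rule subset_trans[OF set_loop_erasure])
  qed
  have edges: "path_edges p \<subseteq> Pow V" if "set p \<subseteq> V" for p
  proof
    fix e assume "e \<in> path_edges p"
    then obtain k where "e = {p ! k, p ! Suc k}" "Suc k < length p"
      by (auto simp: path_edges_def)
    then show "e \<in> Pow V"
      using that nth_mem[of k p] nth_mem[of "Suc k" p] by auto
  qed
  have "fst (G j) \<subseteq> V \<and> snd (G j) \<subseteq> Pow V"
  proof (induction j)
    case 0
    then show ?case using assms(1) by (simp add: wilson_graph_def)
  next
    case (Suc j)
    then show ?case
      using sub[of "fst (G j)" j] edges[OF sub[of "fst (G j)" j]]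
      unfolding wilson_graph_Suc by (simp add: add_branch_def)
  qed
  then show "fst (G j) \<subseteq> V" and "snd (G j) \<subseteq> Pow V" by auto
qed

text \<open>The tree at time \<open>\<tau> i\<close> could contain later iterations with the same
  completion time. But an iteration starts outside the tree and takes a positive finite number of
  steps, so the times strictly increase until termination, and afterwards the graph is
  constant.\<close>

lemma wilson_tree_eq:
  assumes hit: "\<And>j. fst (G j) \<noteq> V \<Longrightarrow> y j 0 \<notin> fst (G j) \<and> (\<exists>t. y j t \<in> fst (G j))"
  shows "wilson_tree V r y (\<tau> i) = G i"
proof -
  have fin: "\<tau> j \<noteq> \<infinity>" for j
  proof (induction j)
    case (Suc j)
    have "hitting_time (fst (G j)) (y j) \<noteq> \<infinity>" if nV: "fst (G j) \<noteq> V"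
    proof -
      obtain t where "y j t \<in> fst (G j)" using hit[OF nV] by blast
      then have "hitting_time (fst (G j)) (y j) \<le> enat t"
        unfolding hitting_time_def by (intro Inf_lower) blast
      then show ?thesis by (cases "hitting_time (fst (G j)) (y j)") auto
    qed
    then show ?case using Suc by (cases "fst (G j) = V") (auto simp: Let_def)
  qed simp
  have less: "\<tau> j < \<tau> (Suc j)" if "fst (G j) \<noteq> V" for j
  proof -
    have "enat 0 < hitting_time (fst (G j)) (y j)"
      unfolding hitting_time_def enat_less_Inf_iff using hit[OF that] by simp
    then have "\<tau> j < \<tau> j + hitting_time (fst (G j)) (y j)"
      using fin[of j] by (cases "\<tau> j"; cases "hitting_time (fst (G j)) (y j)") auto
    then show ?thesis using that by (simp add: Let_def)
  qed
  have step: "\<tau> j \<le> \<tau> (Suc j)" for j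
    by (simp add: Let_def)
  have mono: "\<tau> j \<le> \<tau> k" if "j \<le> k" for j k
    by (rule lift_Suc_mono_le[of \<tau>, OF step that])
  have G: "G j = G i" if "fst (G i) = V" "i \<le> j" for j
    using that(2)
  proof (induction rule: dec_induct)
    case (step j)
    then show ?case using that(1) by (simp only: wilson_graph_Suc simp_thms if_True)
  qed simp
  have sub: "fst (G j) \<subseteq> fst (G i) \<and> snd (G j) \<subseteq> snd (G i)" if "\<tau> j \<le> \<tau> i" for j
  proof (cases "j \<le> i")
    case True
    then show ?thesis using wilson_graph_mono by blast
  next
    case False
    then have "\<tau> (Suc i) \<le> \<tau> j" by (intro mono) simp
    then have "\<not> \<tau> i < \<tau> (Suc i)" using that by (meson leD order_trans)
    then have "fst (G i) = V" using less by blast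
    then show ?thesis using G[of j] False by simp
  qed
  show ?thesis
    unfolding wilson_tree_def using sub by (intro prod_eqI) auto
qed

end

section \<open>Distribution of the Wilson process\<close>

context finite_vertex_set
begin

context
  fixes N :: "'a measure" and r :: 'v and Y :: "nat \<Rightarrow> nat \<Rightarrow> 'a \<Rightarrow> 'v"
  assumes wp: "wilson_process N V r Y" and r: "r \<in> V"
begin

private abbreviation (input) "W i \<omega> \<equiv> wilson_walks V r (\<lambda>j t. Y j t \<omega>) i"
private abbreviation (input) "past i ws \<equiv> {\<omega> \<in> space N. W i \<omega> = ws}"

interpretation N: prob_space N
  using wp by (simp add: wilson_process_def)

lemma Y_measurable: "Y i t \<in> measurable N (count_space UNIV)"
proof -
  have "Y i t \<in> measurable N (count_space V)" using wp by (simp add: wilson_process_def)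
  then show ?thesis by (rule measurable_compose) simp
qed

lemma Y_in: "\<omega> \<in> space N \<Longrightarrow> Y i t \<omega> \<in> V"
  using wp measurable_space[of "Y i t" N "count_space V" \<omega>] by (simp add: wilson_process_def)

lemma wilson_walks_measurable: "W i \<in> measurable N (count_space UNIV)"
proof (induction i)
  case (Suc i)
  have step: "(\<lambda>\<omega>. if fst (wilson_graph r ws) = V then ws
      else ws @ [stopped_walk (fst (wilson_graph r ws)) (\<lambda>t. Y i t \<omega>)]) \<in> measurable N (count_space UNIV)" for ws
    using measurable_compose[OF measurable_stopped_walk(2)[OF Y_measurable], of "\<lambda>w. ws @ [w]" "count_space UNIV"]
    by simp
  show ?case
    using measurable_compose_countable[OF step Suc] by (simp add: Let_def)
qed simp

lemma wilson_time_measurable: "(\<lambda>\<omega>. wilson_time V r (\<lambda>j t. Y j t \<omega>) i) \<in> measurable N (count_space UNIV)"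
proof (induction i)
  case (Suc i)
  have step: "(\<lambda>\<omega>. if fst (wilson_graph r ws) = V then wilson_time V r (\<lambda>j t. Y j t \<omega>) i
      else wilson_time V r (\<lambda>j t. Y j t \<omega>) i + hitting_time (fst (wilson_graph r ws)) (\<lambda>t. Y i t \<omega>))
      \<in> measurable N (count_space UNIV)" for ws
    using Suc measurable_compose_countable2[where h="(+)", OF Suc measurable_stopped_walk(1)[OF Y_measurable]]
    by simp
  show ?case
    using measurable_compose_countable[OF step wilson_walks_measurable[of i]] by (simp add: Let_def)
qed simp

lemma wilson_graph_measurable: "(\<lambda>\<omega>. wilson_graph r (W i \<omega>)) \<in> measurable N (count_space UNIV)"
  by (rule measurable_compose[OF wilson_walks_measurable]) simp

lemma wilson_tree_measurable:
  "(\<lambda>\<omega>. wilson_tree V r (\<lambda>j t. Y j t \<omega>) (wilson_time V r (\<lambda>j t. Y j t \<omega>) i)) \<in> measurable N (count_space UNIV)"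
proof (rule measurable_graph)
  let ?\<tau> = "\<lambda>\<omega>. wilson_time V r (\<lambda>j t. Y j t \<omega>)"
  have [measurable]: "Measurable.pred N (\<lambda>\<omega>. ?\<tau> \<omega> j \<le> ?\<tau> \<omega> i)" for j
    by (rule measurable_compose_countable2[where h="(\<le>)", OF wilson_time_measurable wilson_time_measurable])
  have [measurable]: "Measurable.pred N (\<lambda>\<omega>. v \<in> fst (wilson_graph r (W j \<omega>)))" for j v
    by (rule measurable_compose[OF wilson_graph_measurable]) simp
  have [measurable]: "Measurable.pred N (\<lambda>\<omega>. e \<in> snd (wilson_graph r (W j \<omega>)))" for j e
    by (rule measurable_compose[OF wilson_graph_measurable]) simp
  show "fst (wilson_tree V r (\<lambda>j t. Y j t \<omega>) (?\<tau> \<omega> i)) \<subseteq> V \<and>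
      snd (wilson_tree V r (\<lambda>j t. Y j t \<omega>) (?\<tau> \<omega> i)) \<subseteq> Pow V" if "\<omega> \<in> space N" for \<omega>
    using wilson_graph_sub[of r V "\<lambda>j t. Y j t \<omega>", OF r Y_in[OF that]]
    unfolding wilson_tree_def by (simp add: UN_subset_iff)
  have "v \<in> fst (wilson_tree V r (\<lambda>j t. Y j t \<omega>) (?\<tau> \<omega> i)) \<longleftrightarrow>
      (\<exists>j. ?\<tau> \<omega> j \<le> ?\<tau> \<omega> i \<and> v \<in> fst (wilson_graph r (W j \<omega>)))" for v \<omega>
    by (auto simp: wilson_tree_def)
  then show "Measurable.pred N (\<lambda>\<omega>. v \<in> fst (wilson_tree V r (\<lambda>j t. Y j t \<omega>) (?\<tau> \<omega> i)))" for v
    by (simp only:) measurable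
  have "e \<in> snd (wilson_tree V r (\<lambda>j t. Y j t \<omega>) (?\<tau> \<omega> i)) \<longleftrightarrow>
      (\<exists>j. ?\<tau> \<omega> j \<le> ?\<tau> \<omega> i \<and> e \<in> snd (wilson_graph r (W j \<omega>)))" for e \<omega>
    by (auto simp: wilson_tree_def)
  then show "Measurable.pred N (\<lambda>\<omega>. e \<in> snd (wilson_tree V r (\<lambda>j t. Y j t \<omega>) (?\<tau> \<omega> i)))" for e
    by (simp only:) measurable
qed

lemma past_sets: "past i ws \<in> sets N"
proof -
  have "W i -` {ws} \<inter> space N \<in> sets N" by (rule measurable_sets[OF wilson_walks_measurable]) simp
  moreover have "W i -` {ws} \<inter> space N = past i ws" by auto
  ultimately show ?thesis by simp
qed

lemma past_walk:
  assumes "measure N (past i ws) > 0" and "fst (wilson_graph r ws) \<noteq> V"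
  shows "random_walk (uniform_measure N (past i ws)) V (pmf_of_set (V - fst (wilson_graph r ws))) (Y i)"
    and "r \<in> fst (wilson_graph r ws)" and "fst (wilson_graph r ws) \<subset> V"
proof -
  show "random_walk (uniform_measure N (past i ws)) V (pmf_of_set (V - fst (wilson_graph r ws))) (Y i)"
    using wp assms unfolding wilson_process_def Let_def by blast
  have "past i ws \<noteq> {}" using assms(1) by (metis measure_empty less_irrefl)
  then obtain \<omega> where \<omega>: "\<omega> \<in> space N" "W i \<omega> = ws" by auto
  from wilson_graph_sub[of r V "\<lambda>j t. Y j t \<omega>" i, OF r Y_in[OF \<omega>(1)]] \<omega>(2) assms(2)
  show "r \<in> fst (wilson_graph r ws)" "fst (wilson_graph r ws) \<subset> V" by auto
qed

text \<open>The past takes countably many values, so almost sure statements under the conditional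
  measures combine to one under \<open>N\<close>; values of probability zero are absorbed into a
  null set. The vertex \<open>r\<close> lies in every \<open>V_X\<close> and serves as the one to be
  visited.\<close>

lemma AE_wilson_hits:
  "AE \<omega> in N. \<forall>j. fst (wilson_graph r (W j \<omega>)) \<noteq> V \<longrightarrow>
     Y j 0 \<omega> \<notin> fst (wilson_graph r (W j \<omega>)) \<and> (\<exists>t. Y j t \<omega> \<in> fst (wilson_graph r (W j \<omega>)))"
proof -
  have key: "AE \<omega> in N. W j \<omega> = ws \<longrightarrow> fst (wilson_graph r ws) \<noteq> V \<longrightarrow>
     Y j 0 \<omega> \<notin> fst (wilson_graph r ws) \<and> (\<exists>t. Y j t \<omega> \<in> fst (wilson_graph r ws))" for j ws
  proof (cases "measure N (past j ws) > 0 \<and> fst (wilson_graph r ws) \<noteq> V")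
    case True
    note rw = past_walk[OF True[THEN conjunct1] True[THEN conjunct2]]
    have S: "finite (V - fst (wilson_graph r ws))" "V - fst (wilson_graph r ws) \<noteq> {}"
      using finite_V rw(3) by auto
    have "AE \<omega> in uniform_measure N (past j ws). Y j 0 \<omega> \<notin> fst (wilson_graph r ws) \<and>
        (\<exists>t. Y j t \<omega> \<in> fst (wilson_graph r ws))"
      using AE_random_walk_start[OF rw(1)] AE_walk_visits[OF rw(1) r]
    proof eventually_elim
      case (elim \<omega>)
      then show ?case using S rw(2) by auto
    qed
    then have "AE \<omega> in N. \<omega> \<in> past j ws \<longrightarrow> Y j 0 \<omega> \<notin> fst (wilson_graph r ws) \<and>
        (\<exists>t. Y j t \<omega> \<in> fst (wilson_graph r ws))"
      using True by (subst (asm) AE_uniform_measure) (auto simp: N.emeasure_eq_measure)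
    with AE_space show ?thesis by eventually_elim auto
  next
    case False
    then have "measure N (past j ws) = 0 \<or> fst (wilson_graph r ws) = V"
      using measure_nonneg[of N "past j ws"] by linarith
    then consider "measure N (past j ws) = 0" | "fst (wilson_graph r ws) = V"
      by blast
    then show ?thesis
    proof cases
      case 1
      then have "past j ws \<in> null_sets N" using past_sets by (simp add: null_sets_def N.emeasure_eq_measure)
      from AE_not_in[OF this] AE_space show ?thesis by eventually_elim auto
    qed simp
  qed
  have "AE \<omega> in N. \<forall>j ws. W j \<omega> = ws \<longrightarrow> fst (wilson_graph r ws) \<noteq> V \<longrightarrow>
     Y j 0 \<omega> \<notin> fst (wilson_graph r ws) \<and> (\<exists>t. Y j t \<omega> \<in> fst (wilson_graph r ws))"
    by (intro AE_all_countable[THEN iffD2] allI key)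
  then show ?thesis by eventually_elim blast
qed

text \<open>The conditioning is on the whole list of stopped walks, as in
  \<open>wilson_process\<close>. Its law \<open>q\<close> stays implicit: the next step depends on
  the list through its graph only, and the induction hypothesis gives the image of \<open>q\<close>
  under \<open>wilson_graph r\<close>.\<close>

lemma distr_wilson_graph:
  "distr N (count_space UNIV) (\<lambda>\<omega>. wilson_graph r (W i \<omega>)) = measure_pmf (trees i ({r}, {}))"
proof (induction i)
  case 0
  have "distr N (count_space UNIV) (\<lambda>\<omega>. ({r}, {}) :: 'v set \<times> 'v set set) = return (count_space UNIV) ({r}, {})"
    by (rule N.distr_const) simp
  then show ?case by (simp add: wilson_graph_def return_pmf.rep_eq)
next
  case (Suc i)
  obtain q where q: "distr N (count_space UNIV) (W i) = measure_pmf q"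
    by (rule N.ex_pmf_distr[OF wilson_walks_measurable])
  have "measure_pmf (map_pmf (wilson_graph r) q) = distr N (count_space UNIV) (\<lambda>\<omega>. wilson_graph r (W i \<omega>))"
    unfolding map_pmf_rep_eq q[symmetric]
    by (subst distr_distr) (auto simp: wilson_walks_measurable comp_def)
  then have trees: "map_pmf (wilson_graph r) q = trees i ({r}, {})"
    unfolding Suc by (simp only: measure_pmf_inject)
  have "distr N (count_space UNIV) (\<lambda>\<omega>. wilson_graph r (W (Suc i) \<omega>)) =
    measure_pmf (q \<bind> (\<lambda>ws. grow (wilson_graph r ws)))"
  proof (rule distr_eq_bind_pmf[OF N.prob_space_axioms wilson_walks_measurable q wilson_graph_measurable])
    fix ws assume pos: "measure N (past i ws) > 0"
    let ?T = "wilson_graph r ws" and ?U = "uniform_measure N (past i ws)"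
    have past: "AE \<omega> in ?U. W i \<omega> = ws"
      by (rule AE_uniform_measureI) (auto simp: past_sets)
    have U: "prob_space ?U"
      using pos by (intro prob_space_uniform_measure) (auto simp: N.emeasure_eq_measure)
    have meas: "f \<in> measurable ?U (count_space UNIV)" if "f \<in> measurable N (count_space UNIV)" for f :: "'a \<Rightarrow> 'v set \<times> 'v set set"
      using that by simp
    show "distr ?U (count_space UNIV) (\<lambda>\<omega>. wilson_graph r (W (Suc i) \<omega>)) = measure_pmf (grow ?T)"
    proof (cases "fst ?T = V")
      case True
      have "distr ?U (count_space UNIV) (\<lambda>\<omega>. wilson_graph r (W (Suc i) \<omega>)) = distr ?U (count_space UNIV) (\<lambda>_. ?T)"
      proof (intro distr_cong_AE meas wilson_graph_measurable)
        show "AE \<omega> in ?U. wilson_graph r (W (Suc i) \<omega>) = ?T"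
          using past by eventually_elim (simp add: True Let_def)
      qed auto
      also have "\<dots> = return (count_space UNIV) ?T" by (rule prob_space.distr_const[OF U]) simp
      finally show ?thesis using True by (simp add: grow_def return_pmf.rep_eq)
    next
      case False
      note rw = past_walk[OF pos False]
      have "distr ?U (count_space UNIV) (\<lambda>\<omega>. wilson_graph r (W (Suc i) \<omega>)) =
        distr ?U (count_space UNIV) (\<lambda>\<omega>. add_branch ?T (stopped_walk (fst ?T) (\<lambda>t. Y i t \<omega>)))"
      proof (intro distr_cong_AE meas wilson_graph_measurable)
        show "(\<lambda>\<omega>. add_branch ?T (stopped_walk (fst ?T) (\<lambda>t. Y i t \<omega>))) \<in> measurable N (count_space UNIV)"
          by (rule measurable_compose[OF measurable_stopped_walk(2)[OF Y_measurable]]) simp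
        show "AE \<omega> in ?U. wilson_graph r (W (Suc i) \<omega>) = add_branch ?T (stopped_walk (fst ?T) (\<lambda>t. Y i t \<omega>))"
          using past by eventually_elim (simp add: False Let_def wilson_graph_snoc)
      qed auto
      also have "\<dots> = measure_pmf (grow ?T)"
        using rw by (intro distr_branch) auto
      finally show ?thesis .
    qed
  qed
  also have "q \<bind> (\<lambda>ws. grow (wilson_graph r ws)) = map_pmf (wilson_graph r) q \<bind> grow"
    by (simp add: bind_map_pmf)
  also have "\<dots> = trees (Suc i) ({r}, {})"
    unfolding trees trees_Suc' ..
  finally show ?case .
qed

lemma distr_wilson_tree:
  "distr N (count_space UNIV)
     (\<lambda>\<omega>. wilson_tree V r (\<lambda>j t. Y j t \<omega>) (wilson_time V r (\<lambda>j t. Y j t \<omega>) i)) =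
   measure_pmf (trees i ({r}, {}))"
proof -
  have "distr N (count_space UNIV)
     (\<lambda>\<omega>. wilson_tree V r (\<lambda>j t. Y j t \<omega>) (wilson_time V r (\<lambda>j t. Y j t \<omega>) i)) =
    distr N (count_space UNIV) (\<lambda>\<omega>. wilson_graph r (W i \<omega>))"
  proof (intro distr_cong_AE wilson_tree_measurable wilson_graph_measurable)
    show "AE \<omega> in N. wilson_tree V r (\<lambda>j t. Y j t \<omega>) (wilson_time V r (\<lambda>j t. Y j t \<omega>) i) = wilson_graph r (W i \<omega>)"
      using AE_wilson_hits by eventually_elim (intro wilson_tree_eq, blast)
  qed auto
  then show ?thesis unfolding distr_wilson_graph .
qed

end

end

theorem theorem2:
  fixes n r i :: nat
    and M :: "'a measure" and X :: "nat \<Rightarrow> 'a \<Rightarrow> nat"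
    and N :: "'b measure" and Y :: "nat \<Rightarrow> nat \<Rightarrow> 'b \<Rightarrow> nat"
  assumes "n \<ge> 2" and "r \<in> {1..n}"
    and "random_walk M {1..n} (return_pmf r) X"
    and "wilson_process N {1..n} r Y"
  shows "distr N (count_space UNIV)
           (\<lambda>\<omega>. wilson_tree {1..n} r (\<lambda>j t. Y j t \<omega>)
                  (wilson_time {1..n} r (\<lambda>j t. Y j t \<omega>) i)) =
         distr M (count_space UNIV)
           (\<lambda>\<omega>. AB_tree (\<lambda>t. X t \<omega>) (sigma_in {1..n} (\<lambda>t. X t \<omega>) i))"
proof -
  interpret finite_vertex_set "{1..n}"
    using assms(2) by unfold_locales auto
  show ?thesis
    using distr_wilson_tree[OF assms(4,2)] distr_AB_tree[OF assms(3,2)] by simp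
qed

end
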